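(* Let $\phi^{n-1}\in H^1(\Omega)^M$ and positive $\theta^{n-1}\in H^1(\Omega)$ be given data from the previous time step, and let $(\phi^n,\theta^n)$ be any solution of the spatial multi-phase Penrose--Fife problem (the $n$-th time step of the time discretization, as defined in the context) with source term $q=0$ and convection coefficient $h_c=0$. Put $e^{k}=-\sum_{\alpha=1}^M L_\alpha\phi^{k}_\alpha+c_v\tfrac1{\theta^{k}}$ for $k\in\{n-1,n\}$. Then $$S(e^n,\phi^n)\ \ge\ S(e^{n-1},\phi^{n-1}).$$
   Context: $\Omega\subset\mathbb{R}^d$, $d\in\{1,2,3\}$, is a bounded domain with Lipschitz boundary; $M\in\mathbb{N}$. The constants are $\varepsilon,\beta,\kappa,c_v,\tau>0$ ($\tau$ the time step size), $L_\alpha\ge0$, $T_\alpha>0$ ($\alpha=1,\dots,M$); $L=(L_\alpha)_{\alpha=1}^M$, $\widetilde L=(L_\alpha/T_\alpha)_{\alpha=1}^M$, $K=-I\in\mathbb{R}^{M\times M}$. $(\cdot,\cdot)$ is the $L^2(\Omega)$ scalar product (also for vector-valued functions, understood as the corresponding integral). The Gibbs simplex is $G=\{v\in\mathbb{R}^M:\sum_\alpha v_\alpha=1,\ v_\alpha\ge0\}$, $\mathcal{G}=\{v\in H^1(\Omega)^M: v(x)\in G\text{ a.e. in }\Omega\}$, and $\chi_{\mathcal{G}}$ is $0$ on $\mathcal{G}$ and $+\infty$ elsewhere. Spatial multi-phase Penrose--Fife problem for $q=0$, $h_c=0$: find $\phi^n\in H^1(\Omega)^M$ and positive $\theta^n\in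 H^1(\Omega)$ such that $$a(\phi^n,v-\phi^n)+\chi_{\mathcal{G}}(v)-\chi_{\mathcal{G}}(\phi^n)+b(v-\phi^n,\theta^n)\ge\ell_1^n(v-\phi^n)\quad\forall v\in H^1(\Omega)^M,$$ $$b(\phi^n,w)-c^n(\theta^n,w)=\ell_2^n(w)\quad\forall w\in H^1(\Omega)$$ (so that in particular $\phi^n\in\mathcal{G}$), where for $v,v'\in H^1(\Omega)^M$, $w,w'\in H^1(\Omega)$ $$a(v,v')=\varepsilon(\beta v,v')+\varepsilon\tau(\nabla v,\nabla v'),\qquad b(v,w)=-\tau(L^Tv,w),$$ $$c^n(w,w')=\tau\bigl(\tfrac{c_v}{(\theta^{n-1})^2}w,w'\bigr)+\tau^2(\kappa\nabla w,\nabla w'),$$ $$\ell_1^n(v)=\bigl(\varepsilon\beta\phi^{n-1}-\tau\widetilde L-\tfrac\tau\varepsilon K\phi^{n-1},v\bigr),\qquad \ell_2^n(w)=\bigl(-\tau L^T\phi^{n-1}-\tau\tfrac{c_v}{\theta^{n-1}},w\bigr).$$ These forms are assumed to be well defined (finite) for all arguments in the indicated spaces. The entropy is $$S(e,\phi)=\int_\Omega\Bigl(s(e,\phi)-\tfrac\varepsilon2|\nabla\phi|^2-\tfrac1{2\varepsilon}\phi^TK\phi\Bigr)dx-\chi_{\mathcal{G}}(\phi),\qquad s(e,\phi)=-\sum_{\alpha=1}^M\tfrac{L_\alpha}{T_\alpha}\phi_\alpha+c_v\ln(T),$$ where $T$ is determined from $(e,\phi)$ by $e=-\sum_\alpha L_\alpha\phi_\alpha+c_vT$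 (so $T=1/\theta^{k}$ for $e=e^{k}$). $S$ takes values in the extended reals. *)

theory Defs
  imports "HOL-Analysis.Analysis"
begin

section \<open>Lipschitz domains\<close>

text \<open>Near every boundary point, \<Omega> is the strict epigraph, in some direction \<nu>, of a Lipschitz function
  on the hyperplane orthogonal to \<nu>.\<close>

definition lipschitz_boundary :: "(real ^ 'd) set \<Rightarrow> bool" where
  "lipschitz_boundary \<Omega> \<longleftrightarrow>
     (\<forall>p \<in> frontier \<Omega>. \<exists>r > 0. \<exists>\<nu> \<gamma> C. norm \<nu> = 1 \<and> C-lipschitz_on {y. y \<bullet> \<nu> = 0} \<gamma> \<and>
        \<Omega> \<inter> ball p r = {x \<in> ball p r. \<gamma> (x - (x \<bullet> \<nu>) *\<^sub>R \<nu>) < x \<bullet> \<nu>})"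

definition bounded_lipschitz_domain :: "(real ^ 'd) set \<Rightarrow> bool" where
  "bounded_lipschitz_domain \<Omega> \<longleftrightarrow>
     open \<Omega> \<and> connected \<Omega> \<and> \<Omega> \<noteq> {} \<and> bounded \<Omega> \<and> lipschitz_boundary \<Omega>"

section \<open>Weak gradients and Sobolev spaces\<close>

definition partial_deriv :: "'d \<Rightarrow> (real ^ 'd \<Rightarrow> real) \<Rightarrow> real ^ 'd \<Rightarrow> real" where
  "partial_deriv i f x = frechet_derivative f (at x) (axis i 1)"

primrec C_diff :: "nat \<Rightarrow> (real ^ 'd \<Rightarrow> real) \<Rightarrow> bool" where
  "C_diff 0 f \<longleftrightarrow> continuous_on UNIV f"
| "C_diff (Suc k) f \<longleftrightarrow> (\<forall>x. f differentiable (at x)) \<and> (\<forall>i. C_diff k (partial_deriv i f))"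

definition test_functions :: "(real ^ 'd) set \<Rightarrow> (real ^ 'd \<Rightarrow> real) set" where
  "test_functions \<Omega> =
     {\<eta>. (\<forall>k. C_diff k \<eta>) \<and> compact (closure {x. \<eta> x \<noteq> 0}) \<and> closure {x. \<eta> x \<noteq> 0} \<subseteq> \<Omega>}"

text \<open>Elements of Lebesgue and Sobolev spaces are represented by functions on the whole space; only their
  values almost everywhere in \<Omega> matter.\<close>

definition L2 :: "(real ^ 'd) set \<Rightarrow> (real ^ 'd \<Rightarrow> 'b::euclidean_space) set" where
  "L2 \<Omega> = {f. f \<in> borel_measurable (lebesgue_on \<Omega>) \<and> integrable (lebesgue_on \<Omega>) (\<lambda>x. (norm (f x))\<^sup>2)}"

text \<open>For matrix-valued functions, the inner product of the type is the Frobenius one.\<close>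

definition L2_inner ::
  "(real ^ 'd) set \<Rightarrow> (real ^ 'd \<Rightarrow> 'b::euclidean_space) \<Rightarrow> (real ^ 'd \<Rightarrow> 'b) \<Rightarrow> real" where
  "L2_inner \<Omega> f g = integral\<^sup>L (lebesgue_on \<Omega>) (\<lambda>x. f x \<bullet> g x)"

definition has_weak_gradient ::
  "(real ^ 'd) set \<Rightarrow> (real ^ 'd \<Rightarrow> real) \<Rightarrow> (real ^ 'd \<Rightarrow> real ^ 'd) \<Rightarrow> bool" where
  "has_weak_gradient \<Omega> u g \<longleftrightarrow>
     (\<forall>\<eta> \<in> test_functions \<Omega>. \<forall>i.
        integral\<^sup>L (lebesgue_on \<Omega>) (\<lambda>x. u x * partial_deriv i \<eta> x)
          = - integral\<^sup>L (lebesgue_on \<Omega>) (\<lambda>x. g x $ i * \<eta> x))"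

definition H1 :: "(real ^ 'd) set \<Rightarrow> (real ^ 'd \<Rightarrow> real) set" where
  "H1 \<Omega> = {u \<in> L2 \<Omega>. \<exists>g \<in> L2 \<Omega>. has_weak_gradient \<Omega> u g}"

text \<open>On \<open>H1 \<Omega>\<close> with \<Omega> open, the gradient is determined up to a null set, so that the choice is immaterial.\<close>

definition weak_grad :: "(real ^ 'd) set \<Rightarrow> (real ^ 'd \<Rightarrow> real) \<Rightarrow> real ^ 'd \<Rightarrow> real ^ 'd" where
  "weak_grad \<Omega> u = (SOME g. g \<in> L2 \<Omega> \<and> has_weak_gradient \<Omega> u g)"

definition H1_vec :: "(real ^ 'd) set \<Rightarrow> (real ^ 'd \<Rightarrow> real ^ 'm) set" where
  "H1_vec \<Omega> = {v. \<forall>\<alpha>. (\<lambda>x. v x $ \<alpha>) \<in> H1 \<Omega>}"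

definition weak_grad_vec :: "(real ^ 'd) set \<Rightarrow> (real ^ 'd \<Rightarrow> real ^ 'm) \<Rightarrow> real ^ 'd \<Rightarrow> real ^ 'd ^ 'm" where
  "weak_grad_vec \<Omega> v x = (\<chi> \<alpha>. weak_grad \<Omega> (\<lambda>y. v y $ \<alpha>) x)"

section \<open>Gibbs simplex\<close>

definition gibbs_simplex :: "(real ^ 'm) set" where
  "gibbs_simplex = {v. (\<Sum>\<alpha>\<in>UNIV. v $ \<alpha>) = 1 \<and> (\<forall>\<alpha>. 0 \<le> v $ \<alpha>)}"

definition gibbs_functions :: "(real ^ 'd) set \<Rightarrow> (real ^ 'd \<Rightarrow> real ^ 'm) set" where
  "gibbs_functions \<Omega> = {v \<in> H1_vec \<Omega>. AE x in lebesgue_on \<Omega>. v x \<in> gibbs_simplex}"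

definition chi_gibbs :: "(real ^ 'd) set \<Rightarrow> (real ^ 'd \<Rightarrow> real ^ 'm) \<Rightarrow> ereal" where
  "chi_gibbs \<Omega> v = (if v \<in> gibbs_functions \<Omega> then 0 else \<infinity>)"

section \<open>One time step of the Penrose--Fife problem\<close>

text \<open>The names \<open>\<phi>'\<close> and \<open>\<theta>'\<close> denote the data of the previous time step.\<close>

definition matK :: "real ^ 'm ^ 'm" where
  "matK = - mat 1"

definition L_tilde :: "real ^ 'm \<Rightarrow> real ^ 'm \<Rightarrow> real ^ 'm" where
  "L_tilde L T = (\<chi> \<alpha>. L $ \<alpha> / T $ \<alpha>)"

definition form_a :: "(real ^ 'd) set \<Rightarrow> real \<Rightarrow> real \<Rightarrow> real \<Rightarrow>
    (real ^ 'd \<Rightarrow> real ^ 'm) \<Rightarrow> (real ^ 'd \<Rightarrow> real ^ 'm) \<Rightarrow> real" where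
  "form_a \<Omega> \<epsilon> \<beta> \<tau> v v' =
     \<epsilon> * L2_inner \<Omega> (\<lambda>x. \<beta> *\<^sub>R v x) v'
     + \<epsilon> * \<tau> * L2_inner \<Omega> (weak_grad_vec \<Omega> v) (weak_grad_vec \<Omega> v')"

definition form_b :: "(real ^ 'd) set \<Rightarrow> real \<Rightarrow> real ^ 'm \<Rightarrow>
    (real ^ 'd \<Rightarrow> real ^ 'm) \<Rightarrow> (real ^ 'd \<Rightarrow> real) \<Rightarrow> real" where
  "form_b \<Omega> \<tau> L v w = - \<tau> * L2_inner \<Omega> (\<lambda>x. L \<bullet> v x) w"

definition form_c :: "(real ^ 'd) set \<Rightarrow> real \<Rightarrow> real \<Rightarrow> real \<Rightarrow> (real ^ 'd \<Rightarrow> real) \<Rightarrow>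
    (real ^ 'd \<Rightarrow> real) \<Rightarrow> (real ^ 'd \<Rightarrow> real) \<Rightarrow> real" where
  "form_c \<Omega> \<kappa> c\<^sub>v \<tau> \<theta>' w w' =
     \<tau> * L2_inner \<Omega> (\<lambda>x. c\<^sub>v / (\<theta>' x)\<^sup>2 * w x) w'
     + \<tau>\<^sup>2 * L2_inner \<Omega> (\<lambda>x. \<kappa> *\<^sub>R weak_grad \<Omega> w x) (weak_grad \<Omega> w')"

definition form_l1 :: "(real ^ 'd) set \<Rightarrow> real \<Rightarrow> real \<Rightarrow> real \<Rightarrow> real ^ 'm \<Rightarrow> real ^ 'm \<Rightarrow>
    (real ^ 'd \<Rightarrow> real ^ 'm) \<Rightarrow> (real ^ 'd \<Rightarrow> real ^ 'm) \<Rightarrow> real" where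
  "form_l1 \<Omega> \<epsilon> \<beta> \<tau> L T \<phi>' v =
     L2_inner \<Omega> (\<lambda>x. (\<epsilon> * \<beta>) *\<^sub>R \<phi>' x - \<tau> *\<^sub>R L_tilde L T - (\<tau> / \<epsilon>) *\<^sub>R (matK *v \<phi>' x)) v"

definition form_l2 :: "(real ^ 'd) set \<Rightarrow> real \<Rightarrow> real \<Rightarrow> real ^ 'm \<Rightarrow>
    (real ^ 'd \<Rightarrow> real ^ 'm) \<Rightarrow> (real ^ 'd \<Rightarrow> real) \<Rightarrow> (real ^ 'd \<Rightarrow> real) \<Rightarrow> real" where
  "form_l2 \<Omega> c\<^sub>v \<tau> L \<phi>' \<theta>' w =
     L2_inner \<Omega> (\<lambda>x. - \<tau> * (L \<bullet> \<phi>' x) - \<tau> * (c\<^sub>v / \<theta>' x)) w"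

text \<open>The Bochner integral of a non-integrable function is \<open>0\<close>, hence finiteness of the forms has to be
  expressed as integrability. It is automatic for all terms that do not contain a quotient by \<open>\<theta>'\<close>, being
  products of square integrable functions on a bounded set.\<close>

definition forms_well_defined :: "(real ^ 'd) set \<Rightarrow> real \<Rightarrow> real \<Rightarrow> real ^ 'm \<Rightarrow>
    (real ^ 'd \<Rightarrow> real ^ 'm) \<Rightarrow> (real ^ 'd \<Rightarrow> real) \<Rightarrow> bool" where
  "forms_well_defined \<Omega> c\<^sub>v \<tau> L \<phi>' \<theta>' \<longleftrightarrow>
     (\<forall>w \<in> H1 \<Omega>. \<forall>w' \<in> H1 \<Omega>.
        integrable (lebesgue_on \<Omega>) (\<lambda>x. (c\<^sub>v / (\<theta>' x)\<^sup>2 * w x) * w' x)) \<and>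
     (\<forall>w \<in> H1 \<Omega>.
        integrable (lebesgue_on \<Omega>) (\<lambda>x. (- \<tau> * (L \<bullet> \<phi>' x) - \<tau> * (c\<^sub>v / \<theta>' x)) * w x))"

text \<open>In \<^typ>\<open>ereal\<close>, \<open>\<infinity> - \<infinity> = \<infinity>\<close>: if \<phi> were not in \<open>gibbs_functions \<Omega>\<close>, the inequality
  would be void for \<open>v \<notin> gibbs_functions \<Omega>\<close>, but still false for \<open>v \<in> gibbs_functions \<Omega>\<close>. Since there are
  such \<open>v\<close>, a solution satisfies \<open>\<phi> \<in> gibbs_functions \<Omega>\<close>.\<close>

definition penrose_fife_step :: "(real ^ 'd) set \<Rightarrow> real \<Rightarrow> real \<Rightarrow> real \<Rightarrow> real \<Rightarrow> real \<Rightarrow>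
    real ^ 'm \<Rightarrow> real ^ 'm \<Rightarrow> (real ^ 'd \<Rightarrow> real ^ 'm) \<Rightarrow> (real ^ 'd \<Rightarrow> real) \<Rightarrow>
    (real ^ 'd \<Rightarrow> real ^ 'm) \<Rightarrow> (real ^ 'd \<Rightarrow> real) \<Rightarrow> bool" where
  "penrose_fife_step \<Omega> \<epsilon> \<beta> \<kappa> c\<^sub>v \<tau> L T \<phi>' \<theta>' \<phi> \<theta> \<longleftrightarrow>
     \<phi> \<in> H1_vec \<Omega> \<and> \<theta> \<in> H1 \<Omega> \<and> (AE x in lebesgue_on \<Omega>. 0 < \<theta> x) \<and>
     (\<forall>v \<in> H1_vec \<Omega>.
        ereal (form_a \<Omega> \<epsilon> \<beta> \<tau> \<phi> (v - \<phi>)) + chi_gibbs \<Omega> v - chi_gibbs \<Omega> \<phi>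
          + ereal (form_b \<Omega> \<tau> L (v - \<phi>) \<theta>)
        \<ge> ereal (form_l1 \<Omega> \<epsilon> \<beta> \<tau> L T \<phi>' (v - \<phi>))) \<and>
     (\<forall>w \<in> H1 \<Omega>.
        form_b \<Omega> \<tau> L \<phi> w - form_c \<Omega> \<kappa> c\<^sub>v \<tau> \<theta>' \<theta> w = form_l2 \<Omega> c\<^sub>v \<tau> L \<phi>' \<theta>' w)"

section \<open>Entropy\<close>

text \<open>Meaningful whenever the positive or the negative part of \<open>f\<close> has a finite integral.\<close>

definition ext_integral :: "'a measure \<Rightarrow> ('a \<Rightarrow> real) \<Rightarrow> ereal" where
  "ext_integral M f = enn2ereal (\<integral>\<^sup>+x. ennreal (f x) \<partial>M) - enn2ereal (\<integral>\<^sup>+x. ennreal (- f x) \<partial>M)"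

definition energy :: "real \<Rightarrow> real ^ 'm \<Rightarrow> real ^ 'm \<Rightarrow> real \<Rightarrow> real" where
  "energy c\<^sub>v L p t = - (\<Sum>\<alpha>\<in>UNIV. L $ \<alpha> * p $ \<alpha>) + c\<^sub>v * t"

definition temperature :: "real \<Rightarrow> real ^ 'm \<Rightarrow> real \<Rightarrow> real ^ 'm \<Rightarrow> real" where
  "temperature c\<^sub>v L e p = (THE t. e = energy c\<^sub>v L p t)"

definition entropy_density :: "real \<Rightarrow> real ^ 'm \<Rightarrow> real ^ 'm \<Rightarrow> real \<Rightarrow> real ^ 'm \<Rightarrow> real" where
  "entropy_density c\<^sub>v L T e p =
     - (\<Sum>\<alpha>\<in>UNIV. L $ \<alpha> / T $ \<alpha> * p $ \<alpha>) + c\<^sub>v * ln (temperature c\<^sub>v L e p)"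

text \<open>If \<open>\<phi>\<close> lies in \<open>H1_vec \<Omega>\<close> and \<open>e\<close> has a temperature \<open>1 / \<theta>\<close> with \<open>\<theta>\<close> positive in \<open>H1 \<Omega>\<close>, the integrand
  below can fail to be integrable only because of \<open>- c\<^sub>v ln \<theta>\<close>, whose negative part is integrable; the integral
  is then \<open>\<infinity>\<close>.\<close>

definition entropy :: "(real ^ 'd) set \<Rightarrow> real \<Rightarrow> real \<Rightarrow> real ^ 'm \<Rightarrow> real ^ 'm \<Rightarrow>
    (real ^ 'd \<Rightarrow> real) \<Rightarrow> (real ^ 'd \<Rightarrow> real ^ 'm) \<Rightarrow> ereal" where
  "entropy \<Omega> \<epsilon> c\<^sub>v L T e \<phi> =
     ext_integral (lebesgue_on \<Omega>)
       (\<lambda>x. entropy_density c\<^sub>v L T (e x) (\<phi> x)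
             - \<epsilon> / 2 * (norm (weak_grad_vec \<Omega> \<phi> x))\<^sup>2
             - 1 / (2 * \<epsilon>) * (\<phi> x \<bullet> (matK *v \<phi> x)))
     - chi_gibbs \<Omega> \<phi>"

end

theory Submission
  imports Defs
begin

text \<open>
  Write \<open>\<phi>\<^sub>0, \<theta>\<^sub>0\<close> for the old and \<open>\<phi>\<^sub>1, \<theta>\<^sub>1\<close> for the new phase field and inverse temperature, and
  \<open>\<delta> = \<phi>\<^sub>1 - \<phi>\<^sub>0\<close>. Testing the variational inequality with \<open>v = \<phi>\<^sub>0\<close> and the energy equation with
  \<open>w = \<theta>\<^sub>1\<close>, and dropping terms of known sign, gives
  \<open>0 \<le> - \<epsilon> (\<nabla>\<phi>\<^sub>1, \<nabla>\<delta>) + (L \<bullet> \<delta>, \<theta>\<^sub>1) - (L_tilde, \<delta>) + (1 / \<epsilon>) (\<phi>\<^sub>0, \<delta>)\<close> and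
  \<open>(L \<bullet> \<delta>, \<theta>\<^sub>1) + c\<^sub>v \<integral> (r\<^sup>2 - r) \<le> 0\<close>, where \<open>r = \<theta>\<^sub>1 / \<theta>\<^sub>0\<close>
  (lemmas \<open>phase_increment_inequality\<close> and \<open>energy_equation_inequality\<close>).
  The coupling term cancels when the two are combined. Pointwise, the increment of the entropy density is
  bounded below by the remaining integrand: the gradient term is concave and treated implicitly, the
  term with \<open>K = - I\<close> is convex in the phase field and treated explicitly, and
  \<open>ln r \<le> r - 1 \<le> r\<^sup>2 - r\<close>. Hence the old integrand plus an integrable function with nonnegative
  integral bounds the new integrand from below, and monotonicity of the extended integral concludes,
  also when the new entropy is infinite.

  Two facts on Sobolev functions enter. First, the weak gradient of \<open>\<phi>\<^sub>0 - \<phi>\<^sub>1\<close> is the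
  difference of the weak gradients. This is uniqueness of weak gradients, that is, the fundamental lemma of
  the calculus of variations, for which explicit smooth bump functions on boxes are constructed.
  Second, constants lie in \<open>H1 \<Omega>\<close>. Hence finiteness of the forms makes \<open>1 / \<theta>\<^sub>0\<^sup>2\<close> integrable, so that
  the entropy integral of the old data is finite. This is essential if \<open>\<phi>\<^sub>0\<close> violates the Gibbs
  constraint: the old entropy is then \<open>- \<infinity>\<close>.
\<close>

section \<open>Smooth bump functions on boxes\<close>

text \<open>Derivatives of \<open>exp (- 1 / t)\<close> are polynomials in \<open>1 / t\<close> times \<open>exp (- 1 / t)\<close>; the
  parameter \<open>p\<close> makes the family closed under differentiation.\<close>

definition exp_bump :: "real poly \<Rightarrow> real \<Rightarrow> real" where
  "exp_bump p t = (if t > 0 then poly p (1 / t) * exp (- 1 / t) else 0)"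

lemma poly_mult_exp_minus_tendsto_0:
  fixes p :: "real poly"
  shows "((\<lambda>s. poly p s * exp (- s)) \<longlongrightarrow> 0) at_top"
proof -
  have "((\<lambda>s. \<Sum>i\<le>degree p. coeff p i * (s ^ i / exp s)) \<longlongrightarrow> (\<Sum>i\<le>degree p. coeff p i * 0)) at_top"
    by (intro tendsto_intros tendsto_power_div_exp_0)
  moreover have "(\<Sum>i\<le>degree p. coeff p i * (s ^ i / exp s)) = poly p s * exp (- s)" for s
    by (simp add: poly_altdef sum_distrib_right exp_minus divide_inverse mult.assoc)
  ultimately show ?thesis by simp
qed

lemma exp_bump_has_real_derivative:
  "(exp_bump p has_real_derivative exp_bump ([:0, 0, 1:] * (p - pderiv p)) t) (at t)"
proof -
  consider "t > 0" | "t < 0" | "t = 0" by linarith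
  then show ?thesis
  proof cases
    case 1
    have "((\<lambda>t. poly p (1 / t) * exp (- 1 / t)) has_real_derivative
        exp_bump ([:0, 0, 1:] * (p - pderiv p)) t) (at t)"
      using 1 by (auto intro!: derivative_eq_intros simp: exp_bump_def power2_eq_square field_simps)
    then show ?thesis
      by (rule has_field_derivative_transform_within_open[of _ _ _ "{0<..}"])
        (use 1 in \<open>auto simp: exp_bump_def\<close>)
  next
    case 2
    have "((\<lambda>t. 0) has_real_derivative exp_bump ([:0, 0, 1:] * (p - pderiv p)) t) (at t)"
      using 2 by (simp add: exp_bump_def)
    then show ?thesis
      by (rule has_field_derivative_transform_within_open[of _ _ _ "{..<0}"])
        (use 2 in \<open>auto simp: exp_bump_def\<close>)
  next
    case 3
    have "((\<lambda>h. exp_bump p h / h) \<longlongrightarrow> 0) (at_right 0)"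
    proof -
      have "((\<lambda>h. poly (pCons 0 p) (inverse h) * exp (- inverse h)) \<longlongrightarrow> 0) (at_right 0)"
        by (rule filterlim_compose[OF poly_mult_exp_minus_tendsto_0 filterlim_inverse_at_top_right])
      moreover have "\<forall>\<^sub>F h in at_right 0. poly (pCons 0 p) (inverse h) * exp (- inverse h) = exp_bump p h / h"
        using eventually_at_right_less[of "0::real"]
        by eventually_elim (simp add: exp_bump_def field_simps)
      ultimately show ?thesis by (rule Lim_transform_eventually)
    qed
    moreover have "((\<lambda>h. exp_bump p h / h) \<longlongrightarrow> 0) (at_left 0)"
    proof (rule Lim_transform_eventually[OF tendsto_const])
      show "\<forall>\<^sub>F h in at_left 0. 0 = exp_bump p h / h"
        by (auto simp: eventually_at_filter exp_bump_def)
    qed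
    ultimately have "((\<lambda>h. exp_bump p h / h) \<longlongrightarrow> 0) (at 0)"
      by (simp add: filterlim_split_at)
    then show ?thesis using 3 by (simp add: has_field_derivative_iff exp_bump_def)
  qed
qed

text \<open>The algebra generated by constants and ridge functions \<open>x \<mapsto> exp_bump p (v \<bullet> x + c)\<close>. It is
  closed under partial derivatives, which yields smoothness without Leibniz rules of higher order.\<close>

inductive_set bump_algebra :: "(real ^ 'd \<Rightarrow> real) set" where
  const: "(\<lambda>x. c) \<in> bump_algebra"
| ridge: "(\<lambda>x. exp_bump p (v \<bullet> x + c)) \<in> bump_algebra"
| add: "f \<in> bump_algebra \<Longrightarrow> g \<in> bump_algebra \<Longrightarrow> (\<lambda>x. f x + g x) \<in> bump_algebra"
| mult: "f \<in> bump_algebra \<Longrightarrow> g \<in> bump_algebra \<Longrightarrow> (\<lambda>x. f x * g x) \<in> bump_algebra"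

lemma partial_deriv_eqI:
  assumes "\<And>x. (f has_derivative f' x) (at x)"
  shows "partial_deriv i f = (\<lambda>x. f' x (axis i 1))"
  using frechet_derivative_at[OF assms] by (auto simp: partial_deriv_def fun_eq_iff)

lemma bump_algebra_differentiable:
  fixes f :: "real ^ 'd \<Rightarrow> real"
  assumes "f \<in> bump_algebra"
  shows "(\<forall>x. f differentiable (at x)) \<and> (\<forall>i. partial_deriv i f \<in> bump_algebra)"
  using assms
proof induction
  case (const c)
  have "((\<lambda>x. c) has_derivative (\<lambda>h. 0)) (at x)" for x :: "real ^ 'd" by simp
  then have "partial_deriv i (\<lambda>x. c) = (\<lambda>x :: real ^ 'd. 0)" for i
    by (rule partial_deriv_eqI)
  then show ?case by (simp add: bump_algebra.const)
next
  case (ridge p v c)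
  define q where "q = [:0, 0, 1:] * (p - pderiv p)"
  have "((\<lambda>x. v \<bullet> x + c) has_derivative (\<lambda>h. v \<bullet> h)) (at x)" for x
    by (auto intro!: derivative_eq_intros)
  then have *: "((\<lambda>x. exp_bump p (v \<bullet> x + c)) has_derivative
      (\<lambda>h. exp_bump q (v \<bullet> x + c) * (v \<bullet> h))) (at x)" for x
    using exp_bump_has_real_derivative[of p "v \<bullet> x + c"]
    by (auto simp: q_def has_field_derivative_def dest: has_derivative_compose)
  have "exp_bump q t * a = exp_bump (smult a q) t" for t a
    by (simp add: exp_bump_def)
  then have "partial_deriv i (\<lambda>x. exp_bump p (v \<bullet> x + c)) \<in> bump_algebra" for i
    unfolding partial_deriv_eqI[OF *] by (simp only: bump_algebra.ridge)
  then show ?case using * by (auto simp: differentiable_def)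
next
  case (add f g)
  then have *: "((\<lambda>x. f x + g x) has_derivative
      (\<lambda>h. frechet_derivative f (at x) h + frechet_derivative g (at x) h)) (at x)" for x
    by (intro has_derivative_add) (auto simp: frechet_derivative_works[symmetric])
  have "partial_deriv i (\<lambda>x. f x + g x) = (\<lambda>x. partial_deriv i f x + partial_deriv i g x)" for i
    unfolding partial_deriv_eqI[OF *] by (simp add: partial_deriv_def)
  then show ?case using add * by (auto simp: differentiable_def intro: bump_algebra.add)
next
  case (mult f g)
  then have *: "((\<lambda>x. f x * g x) has_derivative
      (\<lambda>h. f x * frechet_derivative g (at x) h + frechet_derivative f (at x) h * g x)) (at x)" for x
    by (intro has_derivative_mult) (auto simp: frechet_derivative_works[symmetric])
  have "partial_deriv i (\<lambda>x. f x * g x) = (\<lambda>x. f x * partial_deriv i g x + partial_deriv i f x * g x)" for i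
    unfolding partial_deriv_eqI[OF *] by (simp add: partial_deriv_def)
  moreover have "(\<lambda>x. f x * partial_deriv i g x + partial_deriv i f x * g x) \<in> bump_algebra" for i
    using mult by (intro bump_algebra.add bump_algebra.mult) auto
  ultimately show ?case using * by (auto simp: differentiable_def)
qed

lemma bump_algebra_smooth: "f \<in> bump_algebra \<Longrightarrow> C_diff k f"
proof (induction k arbitrary: f)
  case 0
  then show ?case
    using bump_algebra_differentiable[OF 0]
    by (simp add: differentiable_imp_continuous_within continuous_at_imp_continuous_on)
next
  case (Suc k)
  then show ?case using bump_algebra_differentiable[OF Suc.prems] by simp
qed

lemma bump_algebra_prod:
  assumes "finite I" "\<And>i. i \<in> I \<Longrightarrow> f i \<in> bump_algebra"
  shows "(\<lambda>x. \<Prod>i\<in>I. f i x) \<in> bump_algebra"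
  using assms by (induction I rule: finite_induct) (auto intro: bump_algebra.intros)

text \<open>For \<open>n > 0\<close> this is smooth, positive in the open box and zero outside. As
  \<open>exp_bump 1 (n * t)\<close> is the \<open>n\<close>-th root of \<open>exp_bump 1 t\<close>, the values in the box increase to \<open>1\<close>.\<close>

definition box_bump :: "real ^ 'd \<Rightarrow> real ^ 'd \<Rightarrow> nat \<Rightarrow> real ^ 'd \<Rightarrow> real" where
  "box_bump a b n x = (\<Prod>i\<in>UNIV. exp_bump 1 (n * (x $ i - a $ i)) * exp_bump 1 (n * (b $ i - x $ i)))"

lemma exp_bump_1_bounds: "0 \<le> exp_bump 1 t" "exp_bump 1 t \<le> 1"
  by (auto simp: exp_bump_def)

lemma box_bump_bounds: "0 \<le> box_bump a b n x" "box_bump a b n x \<le> 1"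
  unfolding box_bump_def
  by (auto intro!: prod_nonneg prod_le_1 mult_le_one mult_nonneg_nonneg exp_bump_1_bounds)

lemma box_bump_eq_0:
  assumes "x \<notin> box a b"
  shows "box_bump a b n x = 0"
proof -
  obtain i where "x $ i \<le> a $ i \<or> b $ i \<le> x $ i"
    using assms by (auto simp: mem_box_cart not_less)
  then have "exp_bump 1 (n * (x $ i - a $ i)) * exp_bump 1 (n * (b $ i - x $ i)) = 0"
    by (auto simp: exp_bump_def zero_less_mult_iff)
  then show ?thesis
    unfolding box_bump_def by (intro prod_zero) auto
qed

lemma box_bump_in_bump_algebra: "box_bump a b n \<in> bump_algebra"
proof -
  have "(\<lambda>x. exp_bump 1 (n * (x $ i - a $ i))) \<in> bump_algebra" for i
    using bump_algebra.ridge[of 1 "real n *\<^sub>R axis i 1" "- n * a $ i"]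
    by (simp add: inner_axis' algebra_simps)
  moreover have "(\<lambda>x. exp_bump 1 (n * (b $ i - x $ i))) \<in> bump_algebra" for i
    using bump_algebra.ridge[of 1 "- (real n *\<^sub>R axis i 1)" "n * b $ i"]
    by (simp add: inner_axis' algebra_simps)
  ultimately show ?thesis
    unfolding box_bump_def[abs_def] by (intro bump_algebra_prod bump_algebra.mult) auto
qed

lemma box_bump_test_function:
  assumes "cbox a b \<subseteq> \<Omega>"
  shows "box_bump a b n \<in> test_functions \<Omega>"
proof -
  have "{x. box_bump a b n x \<noteq> 0} \<subseteq> cbox a b"
    using box_bump_eq_0 box_subset_cbox by blast
  then have "closure {x. box_bump a b n x \<noteq> 0} \<subseteq> cbox a b"
    by (rule closure_minimal) (rule closed_cbox)
  then show ?thesis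
    using assms bump_algebra_smooth[OF box_bump_in_bump_algebra]
    unfolding test_functions_def
    by (auto simp: compact_eq_bounded_closed intro: bounded_subset[OF bounded_cbox])
qed

lemma exp_bump_1_tendsto:
  assumes "t > 0" shows "(\<lambda>n. exp_bump 1 (real n * t)) \<longlonglongrightarrow> 1"
proof (rule Lim_transform_eventually)
  have "(\<lambda>n. 1 / real n * (- 1 / t)) \<longlonglongrightarrow> 0 * (- 1 / t)"
    by (intro tendsto_intros lim_1_over_n)
  from tendsto_exp[OF this] show "(\<lambda>n. exp (1 / real n * (- 1 / t))) \<longlonglongrightarrow> 1" by simp
  show "\<forall>\<^sub>F n in sequentially. exp (1 / real n * (- 1 / t)) = exp_bump 1 (real n * t)"
    using eventually_gt_at_top[of 0] by eventually_elim (use assms in \<open>simp add: exp_bump_def\<close>)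
qed

lemma box_bump_tendsto: "(\<lambda>n. box_bump a b n x) \<longlonglongrightarrow> indicator (box a b) x"
proof (cases "x \<in> box a b")
  case True
  then have "(\<lambda>n. box_bump a b n x) \<longlonglongrightarrow> (\<Prod>i\<in>(UNIV::'a set). 1 * 1)"
    unfolding box_bump_def mem_box_cart
    by (intro tendsto_prod tendsto_mult exp_bump_1_tendsto) auto
  then show ?thesis using True by simp
next
  case False
  then show ?thesis by (simp add: box_bump_eq_0)
qed

section \<open>Test functions\<close>

lemma test_function_regularity:
  assumes "\<eta> \<in> test_functions \<Omega>"
  shows "\<eta> differentiable (at x)" "continuous_on UNIV \<eta>" "continuous_on UNIV (partial_deriv i \<eta>)"
proof -
  have "C_diff 0 \<eta>" "C_diff (Suc 0) \<eta>"
    using assms unfolding test_functions_def by blast+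
  then show "\<eta> differentiable (at x)" "continuous_on UNIV \<eta>" "continuous_on UNIV (partial_deriv i \<eta>)"
    by auto
qed

lemma test_function_zero_outside:
  assumes "x \<notin> closure {x. \<eta> x \<noteq> 0}"
  shows "\<eta> x = 0" "partial_deriv i \<eta> x = 0"
proof -
  have zero: "\<eta> y = 0" if "y \<notin> closure {x. \<eta> x \<noteq> 0}" for y
    using that closure_subset[of "{x. \<eta> x \<noteq> 0}"] by auto
  from zero[OF assms] show "\<eta> x = 0" .
  have "(\<eta> has_derivative (\<lambda>h. 0)) (at x)"
  proof (rule has_derivative_transform_within_open)
    show "((\<lambda>x. 0) has_derivative (\<lambda>h. 0)) (at x)" by simp
    show "open (- closure {x. \<eta> x \<noteq> 0})" by (intro open_Compl closed_closure)
    show "x \<in> - closure {x. \<eta> x \<noteq> 0}" using assms by blast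
    show "0 = \<eta> y" if "y \<in> - closure {x. \<eta> x \<noteq> 0}" for y
      using zero[of y] that by (metis ComplD)
  qed
  from frechet_derivative_at[OF this, symmetric] show "partial_deriv i \<eta> x = 0"
    by (simp add: partial_deriv_def)
qed

lemma test_function_bounded:
  assumes "\<eta> \<in> test_functions \<Omega>"
  obtains B where "\<And>x. \<bar>\<eta> x\<bar> \<le> B" "\<And>x. \<bar>partial_deriv i \<eta> x\<bar> \<le> B"
proof -
  let ?K = "closure {x. \<eta> x \<noteq> 0}"
  have K: "compact ?K" using assms by (simp add: test_functions_def)
  have "\<exists>B. \<forall>x. \<bar>f x\<bar> \<le> B" if "continuous_on UNIV f" "\<And>x. x \<notin> ?K \<Longrightarrow> f x = 0" for f :: "real ^ 'a \<Rightarrow> real"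
  proof -
    have "bounded (f ` ?K)"
      using compact_imp_bounded[OF compact_continuous_image[OF continuous_on_subset[OF that(1)] K]] by simp
    then obtain B where "\<forall>x\<in>?K. norm (f x) \<le> B" unfolding bounded_iff by auto
    then have "\<bar>f x\<bar> \<le> max B 0" for x
      by (cases "x \<in> ?K") (auto simp: that(2) le_max_iff_disj)
    then show ?thesis by blast
  qed
  from this[OF test_function_regularity(2)[OF assms] test_function_zero_outside(1)[of _ \<eta>]]
    this[OF test_function_regularity(3)[OF assms] test_function_zero_outside(2)[of _ \<eta>]]
  obtain B C where "\<forall>x. \<bar>\<eta> x\<bar> \<le> B" "\<forall>x. \<bar>partial_deriv i \<eta> x\<bar> \<le> C"
    by blast
  then show ?thesis by (intro that[of "max B C"]) (auto simp: le_max_iff_disj)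
qed

lemma continuous_imp_measurable_lebesgue_on:
  "continuous_on UNIV (f :: 'a::euclidean_space \<Rightarrow> 'b::euclidean_space) \<Longrightarrow> f \<in> borel_measurable (lebesgue_on S)"
  by (auto intro!: measurable_restrict_space1 measurable_completion borel_measurable_continuous_onI)

lemma test_function_measurable:
  assumes "\<eta> \<in> test_functions \<Omega>"
  shows "\<eta> \<in> borel_measurable (lebesgue_on S)" "partial_deriv i \<eta> \<in> borel_measurable (lebesgue_on S)"
  using test_function_regularity[OF assms]
  by (auto intro: continuous_imp_measurable_lebesgue_on)

section \<open>The fundamental lemma of the calculus of variations\<close>

text \<open>Bump functions on a box tend to its indicator function, hence \<open>g\<close> has integral zero over every box
  in \<Omega>. Differentiation of the indefinite integral along shrinking cubes gives \<open>g = 0\<close>.\<close>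

lemma fundamental_lemma:
  fixes g :: "real ^ 'd \<Rightarrow> real"
  assumes "open \<Omega>" and g: "integrable (lebesgue_on \<Omega>) g"
    and null: "\<And>\<eta>. \<eta> \<in> test_functions \<Omega> \<Longrightarrow> (\<integral>x. g x * \<eta> x \<partial>lebesgue_on \<Omega>) = 0"
  shows "AE x in lebesgue_on \<Omega>. g x = 0"
proof -
  have \<Omega>: "\<Omega> \<in> sets lebesgue" using \<open>open \<Omega>\<close> by simp
  define f where "f x = indicator \<Omega> x * g x" for x
  have f: "integrable lebesgue f"
    using g \<Omega> by (simp add: integrable_restrict_space f_def[abs_def])
  have box: "integral (cbox a b) f = 0" if "cbox a b \<subseteq> \<Omega>" for a b
  proof -
    have "(\<lambda>n. \<integral>x. g x * box_bump a b n x \<partial>lebesgue_on \<Omega>)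
        \<longlonglongrightarrow> (\<integral>x. g x * indicator (box a b) x \<partial>lebesgue_on \<Omega>)"
    proof (rule integral_dominated_convergence[where w = "\<lambda>x. \<bar>g x\<bar>"])
      show "(\<lambda>x. g x * box_bump a b n x) \<in> borel_measurable (lebesgue_on \<Omega>)" for n
        using g test_function_measurable(1)[OF box_bump_test_function[OF that], of n \<Omega>]
        by (auto intro: borel_measurable_times)
      show "AE x in lebesgue_on \<Omega>. norm (g x * box_bump a b n x) \<le> \<bar>g x\<bar>" for n
        by (auto simp: abs_mult abs_of_nonneg box_bump_bounds intro!: mult_left_le)
      have "indicat_real (box a b) \<in> borel_measurable (lebesgue_on \<Omega>)"
        by (intro measurable_restrict_space1 borel_measurable_indicator) auto
      then show "(\<lambda>x. g x * indicator (box a b) x) \<in> borel_measurable (lebesgue_on \<Omega>)"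
        using g by (auto intro: borel_measurable_times)
      show "integrable (lebesgue_on \<Omega>) (\<lambda>x. \<bar>g x\<bar>)" using g by simp
      show "AE x in lebesgue_on \<Omega>. (\<lambda>n. g x * box_bump a b n x) \<longlonglongrightarrow> g x * indicator (box a b) x"
        by (auto intro!: tendsto_intros box_bump_tendsto)
    qed
    moreover have "(\<integral>x. g x * box_bump a b n x \<partial>lebesgue_on \<Omega>) = 0" for n
      by (rule null[OF box_bump_test_function[OF that]])
    ultimately have "0 = (\<integral>x. g x * indicator (box a b) x \<partial>lebesgue_on \<Omega>)"
      by (simp add: LIMSEQ_const_iff)
    also have "\<dots> = (\<integral>x. indicator (box a b) x *\<^sub>R f x \<partial>lebesgue)"
      by (simp add: integral_restrict_space \<Omega> f_def mult_ac)
    also have "\<dots> = (\<integral>x. f x \<partial>lebesgue_on (box a b))"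
      by (simp add: integral_restrict_space)
    also have "\<dots> = integral (box a b) f"
      by (rule lebesgue_integral_eq_integral) (use f integrable_mult_indicator[of "box a b" lebesgue f] in \<open>auto simp: integrable_restrict_space\<close>)
    finally show ?thesis by (simp add: integral_open_interval)
  qed
  have "f integrable_on cbox a b" for a b
    using integrable_on_lebesgue[OF f] integrable_on_subcbox by blast
  then obtain N where N: "negligible N" "\<And>x e. \<lbrakk>x \<notin> N; 0 < e\<rbrakk> \<Longrightarrow>
      \<exists>d>0. \<forall>h. 0 < h \<and> h < d \<longrightarrow> norm (integral (cbox x (x + h *\<^sub>R One)) f /\<^sub>R h ^ DIM(real ^ 'd) - f x) < e"
    using integrable_ccontinuous_explicit[of f] by blast
  have "g x = 0" if x: "x \<in> \<Omega>" "x \<notin> N" for x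
  proof -
    obtain r where r: "r > 0" "ball x r \<subseteq> \<Omega>"
      using \<open>open \<Omega>\<close> x(1) open_contains_ball by blast
    have "\<bar>g x\<bar> \<le> e" if e: "e > 0" for e
    proof -
      obtain d where d: "d > 0" "\<And>h. 0 < h \<Longrightarrow> h < d \<Longrightarrow>
          norm (integral (cbox x (x + h *\<^sub>R One)) f /\<^sub>R h ^ DIM(real ^ 'd) - f x) < e"
        using N(2)[OF x(2) e] by blast
      \<comment> \<open>The cube of side \<open>h\<close> has diameter at most \<open>h * B\<close>.\<close>
      define B :: real where "B = DIM(real ^ 'd)"
      have B: "B > 0" by (simp add: B_def)
      define h where "h = min (d / 2) (r / (2 * B))"
      have h: "0 < h" "h < d" "h * B < r" using d(1) r(1) B by (auto simp: h_def min_def field_simps)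
      have "cbox x (x + h *\<^sub>R One) \<subseteq> ball x r"
      proof
        fix y assume y: "y \<in> cbox x (x + h *\<^sub>R One)"
        have "dist x y \<le> (\<Sum>i\<in>Basis. \<bar>(y - x) \<bullet> i\<bar>)"
          using norm_le_l1[of "y - x"] by (simp add: dist_norm norm_minus_commute)
        also have "\<dots> \<le> (\<Sum>i\<in>(Basis :: (real ^ 'd) set). h)"
          using y by (intro sum_mono) (auto simp: mem_box inner_diff_left inner_add_left inner_sum_left_Basis)
        also have "\<dots> = h * B" by (simp add: B_def)
        finally show "y \<in> ball x r" using h by simp
      qed
      then have "integral (cbox x (x + h *\<^sub>R One)) f = 0" using r box by blast
      then show ?thesis using d(2)[OF h(1,2)] x by (simp add: f_def)
    qed
    then show ?thesis using field_le_epsilon[of "\<bar>g x\<bar>" 0] by simp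
  qed
  moreover have "AE x in lebesgue. x \<notin> N"
    using N(1) by (simp add: negligible_iff_null_sets AE_not_in)
  ultimately have "AE x in lebesgue. x \<in> \<Omega> \<longrightarrow> g x = 0" by auto
  then show ?thesis using \<Omega> by (simp add: AE_restrict_space_iff)
qed

section \<open>Square integrable functions\<close>

lemma integrable_inner_L2:
  assumes "f \<in> L2 \<Omega>" "g \<in> L2 \<Omega>"
  shows "integrable (lebesgue_on \<Omega>) (\<lambda>x. f x \<bullet> g x)"
proof (rule Bochner_Integration.integrable_bound)
  show "integrable (lebesgue_on \<Omega>) (\<lambda>x. (norm (f x))\<^sup>2 + (norm (g x))\<^sup>2)"
    using assms by (simp add: L2_def)
  show "(\<lambda>x. f x \<bullet> g x) \<in> borel_measurable (lebesgue_on \<Omega>)"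
    using assms by (simp add: L2_def borel_measurable_inner)
  have "\<bar>a \<bullet> b\<bar> \<le> (norm a)\<^sup>2 + (norm b)\<^sup>2" for a b :: 'b
  proof -
    have "\<bar>a \<bullet> b\<bar> \<le> norm a * norm b" by (rule Cauchy_Schwarz_ineq2)
    also have "\<dots> \<le> (norm a)\<^sup>2 + (norm b)\<^sup>2"
      using sum_squares_bound[of "norm a" "norm b"] mult_nonneg_nonneg[OF norm_ge_zero[of a] norm_ge_zero[of b]]
      by linarith
    finally show ?thesis .
  qed
  then show "AE x in lebesgue_on \<Omega>. norm (f x \<bullet> g x) \<le> norm ((norm (f x))\<^sup>2 + (norm (g x))\<^sup>2)"
    by simp
qed

lemma L2_add:
  assumes "f \<in> L2 \<Omega>" "g \<in> L2 \<Omega>"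
  shows "(\<lambda>x. f x + g x) \<in> L2 \<Omega>"
proof -
  have "integrable (lebesgue_on \<Omega>) (\<lambda>x. (norm (f x))\<^sup>2 + 2 * (f x \<bullet> g x) + (norm (g x))\<^sup>2)"
    using assms integrable_inner_L2[OF assms] by (simp add: L2_def)
  moreover have "(norm (f x + g x))\<^sup>2 = (norm (f x))\<^sup>2 + 2 * (f x \<bullet> g x) + (norm (g x))\<^sup>2" for x
    by (simp add: power2_norm_eq_inner inner_add_left inner_add_right inner_commute)
  ultimately show ?thesis using assms by (simp add: L2_def borel_measurable_add)
qed

lemma L2_scaleR: "f \<in> L2 \<Omega> \<Longrightarrow> (\<lambda>x. c *\<^sub>R f x) \<in> L2 \<Omega>"
  by (auto simp: L2_def power_mult_distrib intro: borel_measurable_scaleR)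

lemma L2_diff: "f \<in> L2 \<Omega> \<Longrightarrow> g \<in> L2 \<Omega> \<Longrightarrow> (\<lambda>x. f x - g x) \<in> L2 \<Omega>"
  using L2_add[of f \<Omega> "\<lambda>x. (- 1) *\<^sub>R g x"] L2_scaleR[of g \<Omega> "- 1"] by simp

lemma L2_const:
  assumes "open \<Omega>" "bounded \<Omega>"
  shows "(\<lambda>x. c) \<in> L2 \<Omega>"
proof -
  have "\<Omega> \<in> lmeasurable" using assms by (simp add: bounded_set_imp_lmeasurable)
  then show ?thesis by (auto simp: L2_def intro!: finite_measure.integrable_const finite_measure_lebesgue_on)
qed

lemma borel_measurable_vecI:
  fixes f :: "'a \<Rightarrow> 'b::euclidean_space ^ 'm"
  assumes "\<And>\<alpha>. (\<lambda>x. f x $ \<alpha>) \<in> borel_measurable M"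
  shows "f \<in> borel_measurable M"
proof (subst borel_measurable_euclidean_space, intro ballI)
  fix b :: "'b ^ 'm" assume "b \<in> Basis"
  show "(\<lambda>x. f x \<bullet> b) \<in> borel_measurable M"
    using assms by (simp add: inner_vec_def)
qed

lemma L2_vec:
  fixes f :: "real ^ 'd \<Rightarrow> 'b::euclidean_space ^ 'm"
  assumes "\<And>\<alpha>. (\<lambda>x. f x $ \<alpha>) \<in> L2 \<Omega>"
  shows "f \<in> L2 \<Omega>"
proof -
  have "(norm (f x))\<^sup>2 = (\<Sum>\<alpha>\<in>UNIV. (norm (f x $ \<alpha>))\<^sup>2)" for x
    by (simp add: power2_norm_eq_inner inner_vec_def)
  then show ?thesis
    using assms by (auto simp: L2_def intro!: borel_measurable_vecI)
qed

lemma integrable_times_bounded: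
  fixes f h :: "'a \<Rightarrow> real"
  assumes "integrable M f" "h \<in> borel_measurable M" "\<And>x. \<bar>h x\<bar> \<le> B"
  shows "integrable M (\<lambda>x. f x * h x)"
proof (rule Bochner_Integration.integrable_bound)
  show "integrable M (\<lambda>x. B * f x)" using assms by simp
  show "AE x in M. norm (f x * h x) \<le> norm (B * f x)"
  proof (rule AE_I2)
    fix x
    have "\<bar>f x\<bar> * \<bar>h x\<bar> \<le> \<bar>f x\<bar> * \<bar>B\<bar>" using assms(3)[of x] by (intro mult_left_mono) auto
    then show "norm (f x * h x) \<le> norm (B * f x)" by (simp add: abs_mult mult.commute)
  qed
qed (use assms in auto)

lemma integrable_L2:
  assumes "open \<Omega>" "bounded \<Omega>" "f \<in> L2 \<Omega>"
  shows "integrable (lebesgue_on \<Omega>) (f :: _ \<Rightarrow> real)"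
  using integrable_inner_L2[OF assms(3) L2_const[OF assms(1,2), of 1]] by simp

lemma integrable_L2_vec_nth:
  fixes f :: "real ^ 'd \<Rightarrow> real ^ 'm"
  assumes "open \<Omega>" "bounded \<Omega>" "f \<in> L2 \<Omega>"
  shows "integrable (lebesgue_on \<Omega>) (\<lambda>x. f x $ i)"
  using integrable_inner_L2[OF assms(3) L2_const[OF assms(1,2), of "axis i 1"]]
  by (simp add: inner_axis)

lemma L2_inner_const:
  fixes f :: "real ^ 'd \<Rightarrow> 'b::euclidean_space"
  assumes "f \<in> L2 \<Omega>"
  shows "(\<lambda>x. v \<bullet> f x) \<in> L2 \<Omega>"
proof -
  have m: "(\<lambda>x. v \<bullet> f x) \<in> borel_measurable (lebesgue_on \<Omega>)"
    using assms by (auto simp: L2_def)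
  have "integrable (lebesgue_on \<Omega>) (\<lambda>x. (norm (v \<bullet> f x))\<^sup>2)"
  proof (rule Bochner_Integration.integrable_bound)
    show "integrable (lebesgue_on \<Omega>) (\<lambda>x. (norm v)\<^sup>2 * (norm (f x))\<^sup>2)"
      using assms by (simp add: L2_def)
    have "(norm (v \<bullet> f x))\<^sup>2 \<le> (norm v)\<^sup>2 * (norm (f x))\<^sup>2" for x
      using power_mono[OF Cauchy_Schwarz_ineq2[of v "f x"], of 2] by (simp add: power_mult_distrib)
    then show "AE x in lebesgue_on \<Omega>. norm ((norm (v \<bullet> f x))\<^sup>2) \<le> norm ((norm v)\<^sup>2 * (norm (f x))\<^sup>2)"
      by simp
  qed (use m in measurable)
  then show ?thesis using m by (simp add: L2_def)
qed

section \<open>Weak gradients\<close>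

lemma has_weak_gradient_diff:
  assumes "open \<Omega>" "bounded \<Omega>" "u \<in> L2 \<Omega>" "v \<in> L2 \<Omega>" "g \<in> L2 \<Omega>" "h \<in> L2 \<Omega>"
    and "has_weak_gradient \<Omega> u g" "has_weak_gradient \<Omega> v h"
  shows "has_weak_gradient \<Omega> (\<lambda>x. u x - v x) (\<lambda>x. g x - h x)"
  unfolding has_weak_gradient_def
proof (intro ballI allI)
  fix \<eta> i assume \<eta>: "\<eta> \<in> test_functions \<Omega>"
  obtain B where B: "\<And>x. \<bar>\<eta> x\<bar> \<le> B" "\<And>x. \<bar>partial_deriv i \<eta> x\<bar> \<le> B"
    using test_function_bounded[OF \<eta>] by metis
  have *: "integrable (lebesgue_on \<Omega>) (\<lambda>x. f x * partial_deriv i \<eta> x)" if "f \<in> L2 \<Omega>" for f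
    by (rule integrable_times_bounded[OF integrable_L2[OF assms(1,2) that] test_function_measurable(2)[OF \<eta>] B(2)])
  have **: "integrable (lebesgue_on \<Omega>) (\<lambda>x. f x $ i * \<eta> x)" if "f \<in> L2 \<Omega>" for f
    by (rule integrable_times_bounded[OF integrable_L2_vec_nth[OF assms(1,2) that] test_function_measurable(1)[OF \<eta>] B(1)])
  show "(\<integral>x. (u x - v x) * partial_deriv i \<eta> x \<partial>lebesgue_on \<Omega>)
      = - (\<integral>x. (g x - h x) $ i * \<eta> x \<partial>lebesgue_on \<Omega>)"
    using assms(7,8) \<eta> *[OF assms(3)] *[OF assms(4)] **[OF assms(5)] **[OF assms(6)]
    by (simp add: has_weak_gradient_def left_diff_distrib)
qed

lemma weak_gradient_unique:
  fixes \<Omega> :: "(real ^ 'd) set"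
  assumes "open \<Omega>" "bounded \<Omega>" "g \<in> L2 \<Omega>" "h \<in> L2 \<Omega>"
    and "has_weak_gradient \<Omega> u g" "has_weak_gradient \<Omega> u h"
  shows "AE x in lebesgue_on \<Omega>. g x = h x"
proof -
  have "AE x in lebesgue_on \<Omega>. g x $ i - h x $ i = 0" for i
  proof (rule fundamental_lemma[OF assms(1)])
    have int: "integrable (lebesgue_on \<Omega>) (\<lambda>x. f x $ i)" if "f \<in> L2 \<Omega>"
      for f :: "real ^ 'd \<Rightarrow> real ^ 'd"
      by (rule integrable_L2_vec_nth[OF assms(1,2) that])
    show "integrable (lebesgue_on \<Omega>) (\<lambda>x. g x $ i - h x $ i)"
      using int assms(3,4) by simp
    fix \<eta> assume \<eta>: "\<eta> \<in> test_functions \<Omega>"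
    obtain B where B: "\<And>x. \<bar>\<eta> x\<bar> \<le> B"
      using test_function_bounded[OF \<eta>] by metis
    have *: "integrable (lebesgue_on \<Omega>) (\<lambda>x. f x $ i * \<eta> x)" if "f \<in> L2 \<Omega>" for f
      by (rule integrable_times_bounded[OF int[OF that] test_function_measurable(1)[OF \<eta>] B])
    show "(\<integral>x. (g x $ i - h x $ i) * \<eta> x \<partial>lebesgue_on \<Omega>) = 0"
      using assms(5,6) \<eta> *[OF assms(3)] *[OF assms(4)]
      by (simp add: has_weak_gradient_def left_diff_distrib)
  qed
  then have "AE x in lebesgue_on \<Omega>. \<forall>i. g x $ i - h x $ i = 0"
    by (subst AE_all_countable) simp
  then show ?thesis by eventually_elim (simp add: vec_eq_iff)
qed

lemma weak_grad:
  assumes "u \<in> H1 \<Omega>"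
  shows "weak_grad \<Omega> u \<in> L2 \<Omega>" "has_weak_gradient \<Omega> u (weak_grad \<Omega> u)"
proof -
  have "\<exists>g. g \<in> L2 \<Omega> \<and> has_weak_gradient \<Omega> u g" using assms by (auto simp: H1_def)
  from someI_ex[OF this] show "weak_grad \<Omega> u \<in> L2 \<Omega>" "has_weak_gradient \<Omega> u (weak_grad \<Omega> u)"
    by (auto simp: weak_grad_def)
qed

lemma H1_L2: "u \<in> H1 \<Omega> \<Longrightarrow> u \<in> L2 \<Omega>"
  by (simp add: H1_def)

lemma H1_vec_L2: "v \<in> H1_vec \<Omega> \<Longrightarrow> v \<in> L2 \<Omega>"
  by (rule L2_vec) (simp add: H1_vec_def H1_L2)

lemma weak_grad_vec_L2: "v \<in> H1_vec \<Omega> \<Longrightarrow> weak_grad_vec \<Omega> v \<in> L2 \<Omega>"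
  by (rule L2_vec) (simp add: weak_grad_vec_def H1_vec_def weak_grad)

lemma H1_diff:
  assumes "open \<Omega>" "bounded \<Omega>" "u \<in> H1 \<Omega>" "v \<in> H1 \<Omega>"
  shows "(\<lambda>x. u x - v x) \<in> H1 \<Omega>"
    and "AE x in lebesgue_on \<Omega>. weak_grad \<Omega> (\<lambda>y. u y - v y) x = weak_grad \<Omega> u x - weak_grad \<Omega> v x"
proof -
  note grad = has_weak_gradient_diff[OF assms(1,2) H1_L2[OF assms(3)] H1_L2[OF assms(4)]
      weak_grad(1)[OF assms(3)] weak_grad(1)[OF assms(4)] weak_grad(2)[OF assms(3)] weak_grad(2)[OF assms(4)]]
  have L2: "(\<lambda>x. weak_grad \<Omega> u x - weak_grad \<Omega> v x) \<in> L2 \<Omega>"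
    using assms by (intro L2_diff weak_grad)
  show H1: "(\<lambda>x. u x - v x) \<in> H1 \<Omega>"
    using assms grad L2 by (auto simp: H1_def intro: L2_diff)
  show "AE x in lebesgue_on \<Omega>. weak_grad \<Omega> (\<lambda>y. u y - v y) x = weak_grad \<Omega> u x - weak_grad \<Omega> v x"
    by (rule weak_gradient_unique[OF assms(1,2) weak_grad(1)[OF H1] L2 weak_grad(2)[OF H1] grad])
qed

lemma H1_vec_diff:
  assumes "open \<Omega>" "bounded \<Omega>" "u \<in> H1_vec \<Omega>" "v \<in> H1_vec \<Omega>"
  shows "u - v \<in> H1_vec \<Omega>"
    and "AE x in lebesgue_on \<Omega>. weak_grad_vec \<Omega> (u - v) x = weak_grad_vec \<Omega> u x - weak_grad_vec \<Omega> v x"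
proof -
  show "u - v \<in> H1_vec \<Omega>"
    using assms by (auto simp: H1_vec_def intro: H1_diff)
  have "AE x in lebesgue_on \<Omega>. \<forall>\<alpha>. weak_grad \<Omega> (\<lambda>y. u y $ \<alpha> - v y $ \<alpha>) x =
      weak_grad \<Omega> (\<lambda>y. u y $ \<alpha>) x - weak_grad \<Omega> (\<lambda>y. v y $ \<alpha>) x"
    using assms by (subst AE_all_countable) (auto simp: H1_vec_def intro: H1_diff)
  then show "AE x in lebesgue_on \<Omega>. weak_grad_vec \<Omega> (u - v) x = weak_grad_vec \<Omega> u x - weak_grad_vec \<Omega> v x"
    by eventually_elim (simp add: weak_grad_vec_def vec_eq_iff)
qed

text \<open>By translation invariance, the difference quotients of \<eta> in direction \<open>i\<close> have integral zero. They
  converge to the partial derivative, dominated by its bound on a ball containing their supports.\<close>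

lemma integral_partial_deriv_test_function:
  fixes \<Omega> :: "(real ^ 'd) set"
  assumes \<eta>: "\<eta> \<in> test_functions \<Omega>" and "open \<Omega>"
  shows "(\<integral>x. partial_deriv i \<eta> x \<partial>lebesgue_on \<Omega>) = 0"
proof -
  define e :: "real ^ 'd" where "e = axis i 1"
  define s where "s n = 1 / real (Suc n)" for n
  have s: "s n > 0" "s n \<le> 1" for n by (auto simp: s_def)
  let ?K = "closure {x. \<eta> x \<noteq> 0}"
  note cont = test_function_regularity[OF \<eta>]
  obtain B where B: "\<And>x. \<bar>partial_deriv i \<eta> x\<bar> \<le> B"
    using test_function_bounded[OF \<eta>] by metis
  obtain r where r: "?K \<subseteq> cball 0 r"
    using \<eta> bounded_subset_ballD[OF compact_imp_bounded, of ?K 0] ball_subset_cball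
    unfolding test_functions_def by blast
  have deriv: "((\<lambda>t. \<eta> (x + t *\<^sub>R e)) has_real_derivative partial_deriv i \<eta> (x + t *\<^sub>R e)) (at t)" for x t
  proof -
    have "(\<eta> has_derivative frechet_derivative \<eta> (at (x + t *\<^sub>R e))) (at (x + t *\<^sub>R e))"
      using cont(1) by (simp add: frechet_derivative_works)
    moreover have "((\<lambda>t. x + t *\<^sub>R e) has_derivative (\<lambda>h. h *\<^sub>R e)) (at t)"
      by (auto intro!: derivative_eq_intros)
    ultimately have "((\<lambda>t. \<eta> (x + t *\<^sub>R e)) has_derivative
        (\<lambda>h. frechet_derivative \<eta> (at (x + t *\<^sub>R e)) (h *\<^sub>R e))) (at t)"
      by (rule has_derivative_compose[rotated])
    moreover have "frechet_derivative \<eta> (at (x + t *\<^sub>R e)) (h *\<^sub>R e) = partial_deriv i \<eta> (x + t *\<^sub>R e) * h" for h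
      using linear_scale[OF linear_frechet_derivative[OF cont(1)]]
      by (simp add: partial_deriv_def e_def)
    ultimately show ?thesis by (simp add: has_field_derivative_def)
  qed
  define q where "q n x = (\<eta> (x + s n *\<^sub>R e) - \<eta> x) / s n" for n x
  have meas: "\<eta> \<in> borel_measurable lborel" "(\<lambda>x. \<eta> (x + c)) \<in> borel_measurable lborel"
      "partial_deriv i \<eta> \<in> borel_measurable lborel" for c
    using cont(2,3) by (auto intro!: borel_measurable_continuous_onI continuous_on_compose2[OF cont(2)] continuous_intros)
  have \<eta>_int: "integrable lborel \<eta>"
  proof -
    obtain C where C: "\<And>x. \<bar>\<eta> x\<bar> \<le> C" using test_function_bounded[OF \<eta>] by metis
    show ?thesis
    proof (rule Bochner_Integration.integrable_bound)
      show "integrable lborel (\<lambda>x. indicator (cball 0 r) x * C)"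
        by (intro integrable_mult_left integrable_real_indicator) (auto simp: emeasure_bounded_finite[simplified])
      show "AE x in lborel. norm (\<eta> x) \<le> norm (indicator (cball 0 r) x * C)"
      proof (rule AE_I2)
        fix x
        show "norm (\<eta> x) \<le> norm (indicator (cball 0 r) x * C)"
        proof (cases "x \<in> cball 0 r")
          case True
          then show ?thesis using C[of x] by simp
        next
          case False
          then have "x \<notin> ?K" using r by blast
          then show ?thesis using test_function_zero_outside(1)[of x \<eta>] by simp
        qed
      qed
    qed (use meas in auto)
  qed
  have translate: "(\<integral>x. \<eta> (x + c) \<partial>lborel) = (\<integral>x. \<eta> x \<partial>lborel)" "integrable lborel (\<lambda>x. \<eta> (x + c))" for c
  proof -
    have *: "distr lborel borel (\<lambda>x. x + c) = lborel"
      using lborel_distr_plus[of c] by (simp add: add.commute[of _ c])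
    show "(\<integral>x. \<eta> (x + c) \<partial>lborel) = (\<integral>x. \<eta> x \<partial>lborel)"
      using integral_distr[of "\<lambda>x. x + c" lborel borel \<eta>] meas(1) by (simp add: *)
    show "integrable lborel (\<lambda>x. \<eta> (x + c))"
      using integrable_distr[of "\<lambda>x. x + c" lborel borel \<eta>] \<eta>_int by (simp add: *)
  qed
  have "(\<lambda>n. \<integral>x. q n x \<partial>lborel) \<longlonglongrightarrow> (\<integral>x. partial_deriv i \<eta> x \<partial>lborel)"
    \<comment> \<open>The support of a difference quotient of step size at most \<open>1\<close> lies in the enlarged ball.\<close>
  proof (rule integral_dominated_convergence[where w = "\<lambda>x. indicator (cball 0 (r + 1)) x * B"])
    show "integrable lborel (\<lambda>x::real ^ 'd. indicator (cball 0 (r + 1)) x * B)"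
      by (intro integrable_mult_left integrable_real_indicator) (auto simp: emeasure_bounded_finite[simplified])
    show "q n \<in> borel_measurable lborel" for n
      unfolding q_def using meas by (intro borel_measurable_divide borel_measurable_diff borel_measurable_const)
    show "AE x in lborel. (\<lambda>n. q n x) \<longlonglongrightarrow> partial_deriv i \<eta> x"
    proof (rule AE_I2)
      fix x
      have "((\<lambda>h. (\<eta> (x + h *\<^sub>R e) - \<eta> x) / h) \<longlongrightarrow> partial_deriv i \<eta> x) (at 0)"
        using deriv[of x 0] by (simp add: has_field_derivative_iff)
      moreover have "filterlim s (at 0) sequentially"
        using LIMSEQ_inverse_real_of_nat s(1)
        by (auto simp: filterlim_at s_def[abs_def] inverse_eq_divide)
      ultimately show "(\<lambda>n. q n x) \<longlonglongrightarrow> partial_deriv i \<eta> x"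
        unfolding q_def by (rule filterlim_compose)
    qed
    show "AE x in lborel. norm (q n x) \<le> indicator (cball 0 (r + 1)) x * B" for n
    proof (rule AE_I2)
      fix x
      show "norm (q n x) \<le> indicator (cball 0 (r + 1)) x * B"
      proof (cases "x \<in> cball 0 (r + 1)")
        case True
        obtain t where "\<eta> (x + s n *\<^sub>R e) - \<eta> (x + 0 *\<^sub>R e) = (s n - 0) * partial_deriv i \<eta> (x + t *\<^sub>R e)"
          using MVT2[of 0 "s n" "\<lambda>t. \<eta> (x + t *\<^sub>R e)" "\<lambda>t. partial_deriv i \<eta> (x + t *\<^sub>R e)"] deriv s(1)
          by blast
        then have "q n x = partial_deriv i \<eta> (x + t *\<^sub>R e)" using s(1)[of n] by (simp add: q_def)
        then show ?thesis using B True by simp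
      next
        case False
        have "norm x \<le> norm (x + s n *\<^sub>R e) + norm (s n *\<^sub>R e)"
          using norm_triangle_ineq4[of "x + s n *\<^sub>R e" "s n *\<^sub>R e"] by simp
        moreover have "norm (s n *\<^sub>R e) \<le> 1" using s[of n] by (simp add: e_def)
        ultimately have "x \<notin> ?K" "x + s n *\<^sub>R e \<notin> ?K" using False r by auto
        then have "\<eta> x = 0" "\<eta> (x + s n *\<^sub>R e) = 0" by (auto intro: test_function_zero_outside)
        then show ?thesis using False by (simp add: q_def)
      qed
    qed
  qed (use meas in auto)
  moreover have "(\<integral>x. q n x \<partial>lborel) = 0" for n
    using translate \<eta>_int by (simp add: q_def)
  ultimately have "0 = (\<integral>x. partial_deriv i \<eta> x \<partial>lborel)" by (simp add: LIMSEQ_const_iff)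
  also have "\<dots> = (\<integral>x. partial_deriv i \<eta> x \<partial>lebesgue)"
    using meas(3) by (simp add: integral_completion)
  also have "\<dots> = (\<integral>x. indicator \<Omega> x *\<^sub>R partial_deriv i \<eta> x \<partial>lebesgue)"
  proof (rule Bochner_Integration.integral_cong)
    fix x
    show "partial_deriv i \<eta> x = indicator \<Omega> x *\<^sub>R partial_deriv i \<eta> x"
      using \<eta> test_function_zero_outside(2)[of x \<eta> i] by (cases "x \<in> \<Omega>") (auto simp: test_functions_def)
  qed simp
  also have "\<dots> = (\<integral>x. partial_deriv i \<eta> x \<partial>lebesgue_on \<Omega>)"
    using \<open>open \<Omega>\<close> by (simp add: integral_restrict_space)
  finally show ?thesis by simp
qed

lemma const_H1:
  assumes "open \<Omega>" "bounded \<Omega>"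
  shows "(\<lambda>x. c) \<in> H1 \<Omega>"
proof -
  have "has_weak_gradient \<Omega> (\<lambda>x. c) (\<lambda>x. 0)"
    using integral_partial_deriv_test_function[OF _ assms(1)] by (simp add: has_weak_gradient_def)
  then show ?thesis using assms by (auto simp: H1_def intro!: L2_const bexI[of _ "\<lambda>x. 0"])
qed

section \<open>Extended integrals and the entropy\<close>

lemma ext_integral_mono:
  assumes "AE x in M. f x \<le> g x"
  shows "ext_integral M f \<le> ext_integral M g"
proof -
  have "(\<integral>\<^sup>+x. ennreal (f x) \<partial>M) \<le> (\<integral>\<^sup>+x. ennreal (g x) \<partial>M)"
      "(\<integral>\<^sup>+x. ennreal (- g x) \<partial>M) \<le> (\<integral>\<^sup>+x. ennreal (- f x) \<partial>M)"
    using assms by (auto intro!: nn_integral_mono_AE ennreal_leI elim!: eventually_mono)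
  then show ?thesis
    unfolding ext_integral_def by (intro ereal_minus_mono) (auto simp: less_eq_ennreal.rep_eq)
qed

lemma ext_integral_cong_AE:
  assumes "AE x in M. f x = g x"
  shows "ext_integral M f = ext_integral M g"
  by (intro antisym ext_integral_mono) (use assms in \<open>auto elim!: eventually_mono\<close>)

lemma ext_integral_eq_integral:
  assumes "integrable M f"
  shows "ext_integral M f = ereal (integral\<^sup>L M f)"
proof -
  have "(\<integral>\<^sup>+x. ennreal (f x) \<partial>M) < \<infinity>" "(\<integral>\<^sup>+x. ennreal (- f x) \<partial>M) < \<infinity>"
    using assms by (auto simp: real_integrable_def top.not_eq_extremum)
  then show ?thesis
    by (cases "\<integral>\<^sup>+x. ennreal (f x) \<partial>M"; cases "\<integral>\<^sup>+x. ennreal (- f x) \<partial>M")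
      (simp_all add: ext_integral_def real_lebesgue_integral_def[OF assms])
qed

lemma temperature_energy: "c\<^sub>v > 0 \<Longrightarrow> temperature c\<^sub>v L (energy c\<^sub>v L p t) p = t"
  unfolding temperature_def energy_def by (rule the_equality) auto

lemma entropy_density_energy:
  assumes "c\<^sub>v > 0" "\<theta> > 0"
  shows "entropy_density c\<^sub>v L T (- (\<Sum>\<alpha>\<in>UNIV. L $ \<alpha> * p $ \<alpha>) + c\<^sub>v * (1 / \<theta>)) p =
    - (L_tilde L T \<bullet> p) - c\<^sub>v * ln \<theta>"
  using temperature_energy[OF assms(1), of L p "1 / \<theta>"] assms(2)
  by (simp add: entropy_density_def energy_def L_tilde_def inner_vec_def ln_div)

lemma inner_matK: "x \<bullet> (matK *v y) = - (x \<bullet> y)"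
proof -
  have "matK *v y = - y"
    unfolding matK_def by (metis matrix_vector_mul_lid matrix_vector_mult_diff_rdistrib matrix_vector_mult_0 diff_0)
  then show ?thesis by simp
qed

lemma entropy_eq:
  assumes "c\<^sub>v > 0" "AE x in lebesgue_on \<Omega>. \<theta> x > 0"
  shows "entropy \<Omega> \<epsilon> c\<^sub>v L T (\<lambda>x. - (\<Sum>\<alpha>\<in>UNIV. L $ \<alpha> * \<phi> x $ \<alpha>) + c\<^sub>v * (1 / \<theta> x)) \<phi> =
    ext_integral (lebesgue_on \<Omega>) (\<lambda>x. - (L_tilde L T \<bullet> \<phi> x) - \<epsilon> / 2 * (norm (weak_grad_vec \<Omega> \<phi> x))\<^sup>2
      + 1 / (2 * \<epsilon>) * (norm (\<phi> x))\<^sup>2 - c\<^sub>v * ln (\<theta> x)) - chi_gibbs \<Omega> \<phi>"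
  unfolding entropy_def
proof (intro arg_cong2[where f = minus] ext_integral_cong_AE refl)
  show "AE x in lebesgue_on \<Omega>.
      entropy_density c\<^sub>v L T (- (\<Sum>\<alpha>\<in>UNIV. L $ \<alpha> * \<phi> x $ \<alpha>) + c\<^sub>v * (1 / \<theta> x)) (\<phi> x)
        - \<epsilon> / 2 * (norm (weak_grad_vec \<Omega> \<phi> x))\<^sup>2 - 1 / (2 * \<epsilon>) * (\<phi> x \<bullet> (matK *v \<phi> x)) =
      - (L_tilde L T \<bullet> \<phi> x) - \<epsilon> / 2 * (norm (weak_grad_vec \<Omega> \<phi> x))\<^sup>2
        + 1 / (2 * \<epsilon>) * (norm (\<phi> x))\<^sup>2 - c\<^sub>v * ln (\<theta> x)"
    using assms(2)
  proof eventually_elim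
    case (elim x)
    show ?case
      unfolding entropy_density_energy[OF assms(1) elim] inner_matK power2_norm_eq_inner by simp
  qed
qed

section \<open>Logarithms and quotients of the inverse temperature\<close>

lemma abs_le_1_plus_square: "\<bar>t :: real\<bar> \<le> 1 + t\<^sup>2"
  using zero_le_power2[of "\<bar>t\<bar> - 1"] by (simp add: power2_diff)

text \<open>Used with \<open>r\<close> the quotient of the new and the old inverse temperature: the logarithm comes from the
  entropy increment, the right-hand side from the linearization of \<open>1 / \<theta>\<close> in the time step.\<close>

lemma ln_le_square_minus_self:
  fixes r :: real
  assumes "r > 0"
  shows "ln r \<le> r\<^sup>2 - r"
proof -
  have "ln r \<le> r - 1" by (rule ln_le_minus_one[OF assms])
  moreover have "0 \<le> (r - 1)\<^sup>2" by simp
  ultimately show ?thesis by (simp add: power2_eq_square algebra_simps)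
qed

lemma forms_well_defined_integrable_quotient:
  assumes "forms_well_defined \<Omega> c\<^sub>v \<tau> L \<phi>' \<theta>'" "c\<^sub>v > 0" "w \<in> H1 \<Omega>" "w' \<in> H1 \<Omega>"
  shows "integrable (lebesgue_on \<Omega>) (\<lambda>x. w x * w' x / (\<theta>' x)\<^sup>2)"
proof -
  have "integrable (lebesgue_on \<Omega>) (\<lambda>x. 1 / c\<^sub>v * (c\<^sub>v / (\<theta>' x)\<^sup>2 * w x * w' x))"
    using assms by (intro integrable_mult_right) (simp add: forms_well_defined_def)
  then show ?thesis using \<open>c\<^sub>v > 0\<close> by simp
qed

lemma (in finite_measure) integrable_ln:
  fixes f :: "'a \<Rightarrow> real"
  assumes "integrable M f" "integrable M (\<lambda>x. 1 / (f x)\<^sup>2)" "AE x in M. f x > 0"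
  shows "integrable M (\<lambda>x. ln (f x))"
proof (rule Bochner_Integration.integrable_bound)
  show "integrable M (\<lambda>x. f x + (1 + 1 / (f x)\<^sup>2))"
    using assms by simp
  show "AE x in M. norm (ln (f x)) \<le> norm (f x + (1 + 1 / (f x)\<^sup>2))"
    using assms(3)
  proof eventually_elim
    case (elim x)
    have "ln (f x) \<le> f x - 1" by (rule ln_le_minus_one[OF elim])
    moreover have "- ln (f x) \<le> 1 / f x - 1"
      using ln_le_minus_one[of "1 / f x"] elim by (simp add: ln_div)
    moreover have "1 / f x \<le> 1 + 1 / (f x)\<^sup>2"
      using abs_le_1_plus_square[of "1 / f x"] elim by (simp add: power_divide)
    moreover have "0 \<le> 1 / (f x)\<^sup>2" by simp
    ultimately show ?case using elim by (simp only: real_norm_def)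
  qed
qed (use assms in measurable)

section \<open>Estimates for one time step\<close>

text \<open>A competitor \<open>v\<close> in \<open>gibbs_functions \<Omega>\<close> forces the solution to lie there: otherwise the left-hand side
  of the variational inequality would be \<open>- \<infinity>\<close>.\<close>

lemma penrose_fife_step_gibbs:
  assumes "penrose_fife_step \<Omega> \<epsilon> \<beta> \<kappa> c\<^sub>v \<tau> L T \<phi>' \<theta>' \<phi> \<theta>" "v \<in> gibbs_functions \<Omega>"
  shows "\<phi> \<in> gibbs_functions \<Omega>"
    and "form_a \<Omega> \<epsilon> \<beta> \<tau> \<phi> (v - \<phi>) + form_b \<Omega> \<tau> L (v - \<phi>) \<theta> \<ge> form_l1 \<Omega> \<epsilon> \<beta> \<tau> L T \<phi>' (v - \<phi>)"
proof -
  have ineq: "ereal (form_l1 \<Omega> \<epsilon> \<beta> \<tau> L T \<phi>' (v - \<phi>)) \<le>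
      ereal (form_a \<Omega> \<epsilon> \<beta> \<tau> \<phi> (v - \<phi>)) + chi_gibbs \<Omega> v - chi_gibbs \<Omega> \<phi> + ereal (form_b \<Omega> \<tau> L (v - \<phi>) \<theta>)"
    using assms by (auto simp: penrose_fife_step_def gibbs_functions_def)
  show gibbs: "\<phi> \<in> gibbs_functions \<Omega>"
  proof (rule ccontr)
    assume "\<phi> \<notin> gibbs_functions \<Omega>"
    then show False using ineq assms(2) by (simp add: chi_gibbs_def)
  qed
  show "form_a \<Omega> \<epsilon> \<beta> \<tau> \<phi> (v - \<phi>) + form_b \<Omega> \<tau> L (v - \<phi>) \<theta> \<ge> form_l1 \<Omega> \<epsilon> \<beta> \<tau> L T \<phi>' (v - \<phi>)"
    using ineq gibbs assms(2) by (simp add: chi_gibbs_def)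
qed

text \<open>The phase equation tested with the increment of the phase field, divided by \<open>\<tau>\<close>. The time
  derivative has been dropped: it contributes \<open>\<epsilon> \<beta> / \<tau>\<close> times the squared \<open>L\<^sup>2\<close> norm of the increment.\<close>

lemma phase_increment_inequality:
  assumes \<Omega>: "open \<Omega>" "bounded \<Omega>" and pos: "\<epsilon> > 0" "\<beta> > 0" "\<tau> > 0"
    and \<phi>\<^sub>0: "\<phi>\<^sub>0 \<in> H1_vec \<Omega>" and \<phi>\<^sub>1: "\<phi>\<^sub>1 \<in> H1_vec \<Omega>"
    and ineq: "form_a \<Omega> \<epsilon> \<beta> \<tau> \<phi>\<^sub>1 (\<phi>\<^sub>0 - \<phi>\<^sub>1) + form_b \<Omega> \<tau> L (\<phi>\<^sub>0 - \<phi>\<^sub>1) \<theta>\<^sub>1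
      \<ge> form_l1 \<Omega> \<epsilon> \<beta> \<tau> L T \<phi>\<^sub>0 (\<phi>\<^sub>0 - \<phi>\<^sub>1)"
  defines "G\<^sub>0 \<equiv> weak_grad_vec \<Omega> \<phi>\<^sub>0" and "G\<^sub>1 \<equiv> weak_grad_vec \<Omega> \<phi>\<^sub>1" and "\<delta> \<equiv> \<lambda>x. \<phi>\<^sub>1 x - \<phi>\<^sub>0 x"
  shows "0 \<le> - \<epsilon> * (\<integral>x. G\<^sub>1 x \<bullet> (G\<^sub>1 x - G\<^sub>0 x) \<partial>lebesgue_on \<Omega>) + (\<integral>x. (L \<bullet> \<delta> x) * \<theta>\<^sub>1 x \<partial>lebesgue_on \<Omega>)
    - (\<integral>x. L_tilde L T \<bullet> \<delta> x \<partial>lebesgue_on \<Omega>) + 1 / \<epsilon> * (\<integral>x. \<phi>\<^sub>0 x \<bullet> \<delta> x \<partial>lebesgue_on \<Omega>)"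
    (is "0 \<le> ?R")
proof -
  note I = integrable_inner_L2[where \<Omega> = \<Omega>]
  note L2 = H1_vec_L2[OF \<phi>\<^sub>0] H1_vec_L2[OF \<phi>\<^sub>1]
  note grad_L2 = weak_grad_vec_L2[OF \<phi>\<^sub>0, folded G\<^sub>0_def] weak_grad_vec_L2[OF \<phi>\<^sub>1, folded G\<^sub>1_def]
  note diff = H1_vec_diff[OF \<Omega> \<phi>\<^sub>0 \<phi>\<^sub>1, folded G\<^sub>0_def G\<^sub>1_def]
  have \<delta>: "\<delta> \<in> L2 \<Omega>" unfolding \<delta>_def using L2 by (intro L2_diff)
  have D: "(\<lambda>x. G\<^sub>1 x - G\<^sub>0 x) \<in> L2 \<Omega>" using grad_L2 by (intro L2_diff)
  have c: "(\<lambda>x. L_tilde L T) \<in> L2 \<Omega>" by (rule L2_const[OF \<Omega>])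
  have m: "\<phi>\<^sub>0 - \<phi>\<^sub>1 = (\<lambda>x. - \<delta> x)" by (simp add: \<delta>_def fun_eq_iff)
  have "L2_inner \<Omega> G\<^sub>1 (weak_grad_vec \<Omega> (\<phi>\<^sub>0 - \<phi>\<^sub>1)) = (\<integral>x. - (G\<^sub>1 x \<bullet> (G\<^sub>1 x - G\<^sub>0 x)) \<partial>lebesgue_on \<Omega>)"
    unfolding L2_inner_def
  proof (rule integral_cong_AE)
    show "(\<lambda>x. G\<^sub>1 x \<bullet> weak_grad_vec \<Omega> (\<phi>\<^sub>0 - \<phi>\<^sub>1) x) \<in> borel_measurable (lebesgue_on \<Omega>)"
      using I[OF grad_L2(2) weak_grad_vec_L2[OF diff(1)]] by (rule borel_measurable_integrable)
    show "(\<lambda>x. - (G\<^sub>1 x \<bullet> (G\<^sub>1 x - G\<^sub>0 x))) \<in> borel_measurable (lebesgue_on \<Omega>)"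
      using I[OF grad_L2(2) D] by (intro borel_measurable_uminus borel_measurable_integrable)
    show "AE x in lebesgue_on \<Omega>. G\<^sub>1 x \<bullet> weak_grad_vec \<Omega> (\<phi>\<^sub>0 - \<phi>\<^sub>1) x = - (G\<^sub>1 x \<bullet> (G\<^sub>1 x - G\<^sub>0 x))"
      using diff(2) by eventually_elim (simp add: inner_diff_right)
  qed
  then have a: "form_a \<Omega> \<epsilon> \<beta> \<tau> \<phi>\<^sub>1 (\<phi>\<^sub>0 - \<phi>\<^sub>1) =
      - (\<epsilon> * \<beta>) * (\<integral>x. \<phi>\<^sub>1 x \<bullet> \<delta> x \<partial>lebesgue_on \<Omega>) - \<epsilon> * \<tau> * (\<integral>x. G\<^sub>1 x \<bullet> (G\<^sub>1 x - G\<^sub>0 x) \<partial>lebesgue_on \<Omega>)"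
    by (simp add: form_a_def G\<^sub>1_def[symmetric]) (simp add: L2_inner_def m)
  have b: "form_b \<Omega> \<tau> L (\<phi>\<^sub>0 - \<phi>\<^sub>1) \<theta>\<^sub>1 = \<tau> * (\<integral>x. (L \<bullet> \<delta> x) * \<theta>\<^sub>1 x \<partial>lebesgue_on \<Omega>)"
    by (simp add: form_b_def L2_inner_def m)
  have "form_l1 \<Omega> \<epsilon> \<beta> \<tau> L T \<phi>\<^sub>0 (\<phi>\<^sub>0 - \<phi>\<^sub>1) =
      (\<integral>x. \<tau> * (L_tilde L T \<bullet> \<delta> x) - (\<epsilon> * \<beta> + \<tau> / \<epsilon>) * (\<phi>\<^sub>0 x \<bullet> \<delta> x) \<partial>lebesgue_on \<Omega>)"
    unfolding form_l1_def L2_inner_def m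
    by (intro Bochner_Integration.integral_cong refl)
      (simp add: inner_diff_left inner_matK inner_commute[of "matK *v _"]
        inner_commute[of "\<delta> _" "\<phi>\<^sub>0 _"] distrib_right)
  also have "\<dots> = \<tau> * (\<integral>x. L_tilde L T \<bullet> \<delta> x \<partial>lebesgue_on \<Omega>)
      - (\<epsilon> * \<beta> + \<tau> / \<epsilon>) * (\<integral>x. \<phi>\<^sub>0 x \<bullet> \<delta> x \<partial>lebesgue_on \<Omega>)"
    using I[OF c \<delta>] I[OF L2(1) \<delta>] by simp
  finally have l: "form_l1 \<Omega> \<epsilon> \<beta> \<tau> L T \<phi>\<^sub>0 (\<phi>\<^sub>0 - \<phi>\<^sub>1) = \<tau> * (\<integral>x. L_tilde L T \<bullet> \<delta> x \<partial>lebesgue_on \<Omega>)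
      - (\<epsilon> * \<beta> + \<tau> / \<epsilon>) * (\<integral>x. \<phi>\<^sub>0 x \<bullet> \<delta> x \<partial>lebesgue_on \<Omega>)" .
  have "(\<integral>x. \<phi>\<^sub>1 x \<bullet> \<delta> x \<partial>lebesgue_on \<Omega>) - (\<integral>x. \<phi>\<^sub>0 x \<bullet> \<delta> x \<partial>lebesgue_on \<Omega>)
      = (\<integral>x. \<phi>\<^sub>1 x \<bullet> \<delta> x - \<phi>\<^sub>0 x \<bullet> \<delta> x \<partial>lebesgue_on \<Omega>)"
    using I[OF L2(2) \<delta>] I[OF L2(1) \<delta>] by simp
  also have "\<dots> = (\<integral>x. \<delta> x \<bullet> \<delta> x \<partial>lebesgue_on \<Omega>)"
    by (simp add: \<delta>_def inner_diff_left)
  finally have "0 \<le> (\<integral>x. \<phi>\<^sub>1 x \<bullet> \<delta> x \<partial>lebesgue_on \<Omega>) - (\<integral>x. \<phi>\<^sub>0 x \<bullet> \<delta> x \<partial>lebesgue_on \<Omega>)" by simp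
  then have "0 \<le> (\<epsilon> * \<beta>) * ((\<integral>x. \<phi>\<^sub>1 x \<bullet> \<delta> x \<partial>lebesgue_on \<Omega>) - (\<integral>x. \<phi>\<^sub>0 x \<bullet> \<delta> x \<partial>lebesgue_on \<Omega>))"
    using pos by simp
  also have "\<dots> \<le> \<tau> * ?R"
    using ineq unfolding a b l by (simp add: algebra_simps)
  finally show ?thesis using \<open>\<tau> > 0\<close> by (simp add: zero_le_mult_iff)
qed

text \<open>The energy equation tested with the new inverse temperature, divided by \<open>\<tau>\<close>; heat conduction has been
  dropped, being dissipative.\<close>

lemma energy_equation_inequality:
  assumes pos: "\<kappa> > 0" "\<tau> > 0"
    and \<phi>\<^sub>0: "\<phi>\<^sub>0 \<in> L2 \<Omega>" and \<phi>\<^sub>1: "\<phi>\<^sub>1 \<in> L2 \<Omega>" and \<theta>\<^sub>1: "\<theta>\<^sub>1 \<in> L2 \<Omega>"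
    and int_q: "integrable (lebesgue_on \<Omega>) (\<lambda>x. \<theta>\<^sub>1 x / \<theta>\<^sub>0 x)"
    and int_sq: "integrable (lebesgue_on \<Omega>) (\<lambda>x. (\<theta>\<^sub>1 x / \<theta>\<^sub>0 x)\<^sup>2)"
    and eq: "form_b \<Omega> \<tau> L \<phi>\<^sub>1 \<theta>\<^sub>1 - form_c \<Omega> \<kappa> c\<^sub>v \<tau> \<theta>\<^sub>0 \<theta>\<^sub>1 \<theta>\<^sub>1 = form_l2 \<Omega> c\<^sub>v \<tau> L \<phi>\<^sub>0 \<theta>\<^sub>0 \<theta>\<^sub>1"
  shows "(\<integral>x. (L \<bullet> (\<phi>\<^sub>1 x - \<phi>\<^sub>0 x)) * \<theta>\<^sub>1 x \<partial>lebesgue_on \<Omega>)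
    + c\<^sub>v * (\<integral>x. (\<theta>\<^sub>1 x / \<theta>\<^sub>0 x)\<^sup>2 - \<theta>\<^sub>1 x / \<theta>\<^sub>0 x \<partial>lebesgue_on \<Omega>) \<le> 0" (is "?R \<le> 0")
proof -
  have int_L: "integrable (lebesgue_on \<Omega>) (\<lambda>x. (L \<bullet> f x) * \<theta>\<^sub>1 x)" if "f \<in> L2 \<Omega>" for f
    using integrable_inner_L2[OF L2_inner_const[OF that] \<theta>\<^sub>1] by simp
  have grad: "0 \<le> L2_inner \<Omega> (\<lambda>x. \<kappa> *\<^sub>R weak_grad \<Omega> \<theta>\<^sub>1 x) (weak_grad \<Omega> \<theta>\<^sub>1)"
    using \<open>\<kappa> > 0\<close> by (simp add: L2_inner_def)
  have "L2_inner \<Omega> (\<lambda>x. c\<^sub>v / (\<theta>\<^sub>0 x)\<^sup>2 * \<theta>\<^sub>1 x) \<theta>\<^sub>1 = (\<integral>x. c\<^sub>v * (\<theta>\<^sub>1 x / \<theta>\<^sub>0 x)\<^sup>2 \<partial>lebesgue_on \<Omega>)"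
    by (simp add: L2_inner_def power_divide power2_eq_square mult.assoc)
  then have c: "form_c \<Omega> \<kappa> c\<^sub>v \<tau> \<theta>\<^sub>0 \<theta>\<^sub>1 \<theta>\<^sub>1 = \<tau> * (c\<^sub>v * (\<integral>x. (\<theta>\<^sub>1 x / \<theta>\<^sub>0 x)\<^sup>2 \<partial>lebesgue_on \<Omega>))
      + \<tau>\<^sup>2 * L2_inner \<Omega> (\<lambda>x. \<kappa> *\<^sub>R weak_grad \<Omega> \<theta>\<^sub>1 x) (weak_grad \<Omega> \<theta>\<^sub>1)"
    by (simp add: form_c_def)
  have b: "form_b \<Omega> \<tau> L \<phi>\<^sub>1 \<theta>\<^sub>1 = - \<tau> * (\<integral>x. (L \<bullet> \<phi>\<^sub>1 x) * \<theta>\<^sub>1 x \<partial>lebesgue_on \<Omega>)"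
    by (simp add: form_b_def L2_inner_def)
  have "form_l2 \<Omega> c\<^sub>v \<tau> L \<phi>\<^sub>0 \<theta>\<^sub>0 \<theta>\<^sub>1 =
      (\<integral>x. - \<tau> * ((L \<bullet> \<phi>\<^sub>0 x) * \<theta>\<^sub>1 x) - \<tau> * c\<^sub>v * (\<theta>\<^sub>1 x / \<theta>\<^sub>0 x) \<partial>lebesgue_on \<Omega>)"
    by (simp add: form_l2_def L2_inner_def left_diff_distrib mult.assoc)
  also have "\<dots> = - \<tau> * (\<integral>x. (L \<bullet> \<phi>\<^sub>0 x) * \<theta>\<^sub>1 x \<partial>lebesgue_on \<Omega>)
      - \<tau> * c\<^sub>v * (\<integral>x. \<theta>\<^sub>1 x / \<theta>\<^sub>0 x \<partial>lebesgue_on \<Omega>)"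
    using int_L[OF \<phi>\<^sub>0] int_q
    by (subst Bochner_Integration.integral_diff)
      (auto intro!: integrable_mult_right simp only: integral_mult_right_zero)
  finally have l: "form_l2 \<Omega> c\<^sub>v \<tau> L \<phi>\<^sub>0 \<theta>\<^sub>0 \<theta>\<^sub>1 = - \<tau> * (\<integral>x. (L \<bullet> \<phi>\<^sub>0 x) * \<theta>\<^sub>1 x \<partial>lebesgue_on \<Omega>)
      - \<tau> * c\<^sub>v * (\<integral>x. \<theta>\<^sub>1 x / \<theta>\<^sub>0 x \<partial>lebesgue_on \<Omega>)" .
  have "(\<integral>x. (L \<bullet> (\<phi>\<^sub>1 x - \<phi>\<^sub>0 x)) * \<theta>\<^sub>1 x \<partial>lebesgue_on \<Omega>)
      = (\<integral>x. (L \<bullet> \<phi>\<^sub>1 x) * \<theta>\<^sub>1 x - (L \<bullet> \<phi>\<^sub>0 x) * \<theta>\<^sub>1 x \<partial>lebesgue_on \<Omega>)"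
    by (simp add: inner_diff_right left_diff_distrib)
  also have "\<dots> = (\<integral>x. (L \<bullet> \<phi>\<^sub>1 x) * \<theta>\<^sub>1 x \<partial>lebesgue_on \<Omega>) - (\<integral>x. (L \<bullet> \<phi>\<^sub>0 x) * \<theta>\<^sub>1 x \<partial>lebesgue_on \<Omega>)"
    using int_L[OF \<phi>\<^sub>0] int_L[OF \<phi>\<^sub>1] by simp
  finally have d: "(\<integral>x. (L \<bullet> (\<phi>\<^sub>1 x - \<phi>\<^sub>0 x)) * \<theta>\<^sub>1 x \<partial>lebesgue_on \<Omega>) =
      (\<integral>x. (L \<bullet> \<phi>\<^sub>1 x) * \<theta>\<^sub>1 x \<partial>lebesgue_on \<Omega>) - (\<integral>x. (L \<bullet> \<phi>\<^sub>0 x) * \<theta>\<^sub>1 x \<partial>lebesgue_on \<Omega>)" .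
  have "\<tau> * ?R = - \<tau>\<^sup>2 * L2_inner \<Omega> (\<lambda>x. \<kappa> *\<^sub>R weak_grad \<Omega> \<theta>\<^sub>1 x) (weak_grad \<Omega> \<theta>\<^sub>1)"
    using eq int_sq int_q unfolding b c l d by (simp add: algebra_simps)
  also have "\<dots> \<le> 0" using grad by simp
  finally show ?thesis using \<open>\<tau> > 0\<close> by (simp add: mult_le_0_iff)
qed

theorem proposition3p1:
  fixes \<Omega> :: "(real ^ 'd) set"
    and \<epsilon> \<beta> \<kappa> c\<^sub>v \<tau> :: real
    and L T :: "real ^ 'm"
    and \<phi>\<^sub>0 \<phi>\<^sub>1 :: "real ^ 'd \<Rightarrow> real ^ 'm"
    and \<theta>\<^sub>0 \<theta>\<^sub>1 :: "real ^ 'd \<Rightarrow> real"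
    and e\<^sub>0 e\<^sub>1 :: "real ^ 'd \<Rightarrow> real"
  assumes "CARD('d) \<in> {1, 2, 3}"
    and "bounded_lipschitz_domain \<Omega>"
    and "\<epsilon> > 0" and "\<beta> > 0" and "\<kappa> > 0" and "c\<^sub>v > 0" and "\<tau> > 0"
    and "\<And>\<alpha>. L $ \<alpha> \<ge> 0" and "\<And>\<alpha>. T $ \<alpha> > 0"
    and "\<phi>\<^sub>0 \<in> H1_vec \<Omega>"
    and "\<theta>\<^sub>0 \<in> H1 \<Omega>" and "AE x in lebesgue_on \<Omega>. \<theta>\<^sub>0 x > 0"
    and "forms_well_defined \<Omega> c\<^sub>v \<tau> L \<phi>\<^sub>0 \<theta>\<^sub>0"
    and "penrose_fife_step \<Omega> \<epsilon> \<beta> \<kappa> c\<^sub>v \<tau> L T \<phi>\<^sub>0 \<theta>\<^sub>0 \<phi>\<^sub>1 \<theta>\<^sub>1"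
    and "e\<^sub>0 = (\<lambda>x. - (\<Sum>\<alpha>\<in>UNIV. L $ \<alpha> * \<phi>\<^sub>0 x $ \<alpha>) + c\<^sub>v * (1 / \<theta>\<^sub>0 x))"
    and "e\<^sub>1 = (\<lambda>x. - (\<Sum>\<alpha>\<in>UNIV. L $ \<alpha> * \<phi>\<^sub>1 x $ \<alpha>) + c\<^sub>v * (1 / \<theta>\<^sub>1 x))"
  shows "entropy \<Omega> \<epsilon> c\<^sub>v L T e\<^sub>1 \<phi>\<^sub>1 \<ge> entropy \<Omega> \<epsilon> c\<^sub>v L T e\<^sub>0 \<phi>\<^sub>0"
proof -
  note \<phi>\<^sub>0 = \<open>\<phi>\<^sub>0 \<in> H1_vec \<Omega>\<close> and \<theta>\<^sub>0 = \<open>\<theta>\<^sub>0 \<in> H1 \<Omega>\<close> and \<theta>\<^sub>0_pos = assms(12) and step = assms(14)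
  define M where "M = lebesgue_on \<Omega>"
  have \<Omega>: "open \<Omega>" "bounded \<Omega>"
    using assms(2) by (auto simp: bounded_lipschitz_domain_def)
  interpret M: finite_measure M
    using \<Omega> unfolding M_def by (intro finite_measure_lebesgue_on) (simp add: bounded_set_imp_lmeasurable)
  have \<phi>\<^sub>1: "\<phi>\<^sub>1 \<in> H1_vec \<Omega>" and \<theta>\<^sub>1: "\<theta>\<^sub>1 \<in> H1 \<Omega>" and \<theta>\<^sub>1_pos: "AE x in lebesgue_on \<Omega>. \<theta>\<^sub>1 x > 0"
    and eq: "form_b \<Omega> \<tau> L \<phi>\<^sub>1 \<theta>\<^sub>1 - form_c \<Omega> \<kappa> c\<^sub>v \<tau> \<theta>\<^sub>0 \<theta>\<^sub>1 \<theta>\<^sub>1 = form_l2 \<Omega> c\<^sub>v \<tau> L \<phi>\<^sub>0 \<theta>\<^sub>0 \<theta>\<^sub>1"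
    using step unfolding penrose_fife_step_def by blast+
  define G\<^sub>0 G\<^sub>1 where "G\<^sub>0 = weak_grad_vec \<Omega> \<phi>\<^sub>0" and "G\<^sub>1 = weak_grad_vec \<Omega> \<phi>\<^sub>1"
  note L2 = H1_vec_L2[OF \<phi>\<^sub>0] H1_vec_L2[OF \<phi>\<^sub>1] H1_L2[OF \<theta>\<^sub>0] H1_L2[OF \<theta>\<^sub>1]
  note grad_L2 = weak_grad_vec_L2[OF \<phi>\<^sub>0, folded G\<^sub>0_def] weak_grad_vec_L2[OF \<phi>\<^sub>1, folded G\<^sub>1_def]
  note I = integrable_inner_L2[where \<Omega> = \<Omega>, folded M_def]
  note quot = forms_well_defined_integrable_quotient[OF assms(13) \<open>c\<^sub>v > 0\<close>, folded M_def]

  have int_ln: "integrable M (\<lambda>x. ln (\<theta>\<^sub>0 x))"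
  proof (rule M.integrable_ln)
    show "integrable M \<theta>\<^sub>0" using integrable_L2[OF \<Omega> L2(3)] by (simp add: M_def)
    show "integrable M (\<lambda>x. 1 / (\<theta>\<^sub>0 x)\<^sup>2)" using quot[OF const_H1[OF \<Omega>] const_H1[OF \<Omega>], of 1 1] by simp
  qed (unfold M_def, rule \<theta>\<^sub>0_pos)
  define A\<^sub>0 A\<^sub>1 where
    "A\<^sub>0 x = - (L_tilde L T \<bullet> \<phi>\<^sub>0 x) - \<epsilon> / 2 * (norm (G\<^sub>0 x))\<^sup>2 + 1 / (2 * \<epsilon>) * (norm (\<phi>\<^sub>0 x))\<^sup>2" and
    "A\<^sub>1 x = - (L_tilde L T \<bullet> \<phi>\<^sub>1 x) - \<epsilon> / 2 * (norm (G\<^sub>1 x))\<^sup>2 + 1 / (2 * \<epsilon>) * (norm (\<phi>\<^sub>1 x))\<^sup>2" for x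
  have S: "entropy \<Omega> \<epsilon> c\<^sub>v L T e\<^sub>0 \<phi>\<^sub>0 = ext_integral M (\<lambda>x. A\<^sub>0 x - c\<^sub>v * ln (\<theta>\<^sub>0 x)) - chi_gibbs \<Omega> \<phi>\<^sub>0"
     "entropy \<Omega> \<epsilon> c\<^sub>v L T e\<^sub>1 \<phi>\<^sub>1 = ext_integral M (\<lambda>x. A\<^sub>1 x - c\<^sub>v * ln (\<theta>\<^sub>1 x)) - chi_gibbs \<Omega> \<phi>\<^sub>1"
    unfolding assms(15,16) A\<^sub>0_def A\<^sub>1_def G\<^sub>0_def G\<^sub>1_def M_def
    by (rule entropy_eq[OF \<open>c\<^sub>v > 0\<close> \<theta>\<^sub>0_pos] entropy_eq[OF \<open>c\<^sub>v > 0\<close> \<theta>\<^sub>1_pos])+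
  have int_f\<^sub>0: "integrable M (\<lambda>x. A\<^sub>0 x - c\<^sub>v * ln (\<theta>\<^sub>0 x))"
    unfolding A\<^sub>0_def using int_ln L2(1) grad_L2(1) I[OF L2_const[OF \<Omega>] L2(1)]
    by (auto simp: M_def L2_def)
  show ?thesis
  proof (cases "\<phi>\<^sub>0 \<in> gibbs_functions \<Omega>")
    case False
    \<comment> \<open>The old entropy is \<open>- \<infinity>\<close>; this needs the finiteness of its integral, since \<open>\<infinity> - \<infinity> = \<infinity>\<close>.\<close>
    then show ?thesis by (simp add: S ext_integral_eq_integral[OF int_f\<^sub>0] chi_gibbs_def)
  next
    case True
    note gibbs = penrose_fife_step_gibbs[OF step True]
    define \<delta> where "\<delta> x = \<phi>\<^sub>1 x - \<phi>\<^sub>0 x" for x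
    have \<delta>: "\<delta> \<in> L2 \<Omega>" unfolding \<delta>_def using L2 by (intro L2_diff)
    have D: "(\<lambda>x. G\<^sub>1 x - G\<^sub>0 x) \<in> L2 \<Omega>" using grad_L2 by (intro L2_diff)
    have c: "(\<lambda>x. L_tilde L T) \<in> L2 \<Omega>" by (rule L2_const[OF \<Omega>])
    have int_sq: "integrable M (\<lambda>x. (\<theta>\<^sub>1 x / \<theta>\<^sub>0 x)\<^sup>2)"
      using quot[OF \<theta>\<^sub>1 \<theta>\<^sub>1] by (simp add: power_divide power2_eq_square)
    have int_q: "integrable M (\<lambda>x. \<theta>\<^sub>1 x / \<theta>\<^sub>0 x)"
    proof (rule Bochner_Integration.integrable_bound)
      show "integrable M (\<lambda>x. 1 + (\<theta>\<^sub>1 x / \<theta>\<^sub>0 x)\<^sup>2)"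
        using int_sq by simp
      show "(\<lambda>x. \<theta>\<^sub>1 x / \<theta>\<^sub>0 x) \<in> borel_measurable M"
        using L2(3,4) by (auto simp: L2_def M_def intro: borel_measurable_divide)
      show "AE x in M. norm (\<theta>\<^sub>1 x / \<theta>\<^sub>0 x) \<le> norm (1 + (\<theta>\<^sub>1 x / \<theta>\<^sub>0 x)\<^sup>2)"
        using abs_le_1_plus_square by (intro AE_I2) (metis abs_ge_self order_trans real_norm_def)
    qed
    have int_r: "integrable M (\<lambda>x. (\<theta>\<^sub>1 x / \<theta>\<^sub>0 x)\<^sup>2 - \<theta>\<^sub>1 x / \<theta>\<^sub>0 x)"
      using int_sq int_q by simp
    note phase = phase_increment_inequality[OF \<Omega> \<open>\<epsilon> > 0\<close> \<open>\<beta> > 0\<close> \<open>\<tau> > 0\<close> \<phi>\<^sub>0 \<phi>\<^sub>1 gibbs(2),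
        folded G\<^sub>0_def G\<^sub>1_def M_def \<delta>_def]
    note temp = energy_equation_inequality[OF \<open>\<kappa> > 0\<close> \<open>\<tau> > 0\<close> L2(1,2,4) int_q[unfolded M_def]
        int_sq[unfolded M_def] eq, folded M_def \<delta>_def]

    \<comment> \<open>A pointwise lower bound for the difference of the two entropy integrands whose integral is
      nonnegative. The new integrand need not be integrable.\<close>
    define g where "g x = - \<epsilon> * (G\<^sub>1 x \<bullet> (G\<^sub>1 x - G\<^sub>0 x)) - L_tilde L T \<bullet> \<delta> x + (1 / \<epsilon>) * (\<phi>\<^sub>0 x \<bullet> \<delta> x)
      - c\<^sub>v * ((\<theta>\<^sub>1 x / \<theta>\<^sub>0 x)\<^sup>2 - \<theta>\<^sub>1 x / \<theta>\<^sub>0 x)" for x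
    have int_g: "integrable M g"
      unfolding g_def using I[OF grad_L2(2) D] I[OF c \<delta>] I[OF L2(1) \<delta>] int_r by simp
    have "integral\<^sup>L M g = - \<epsilon> * (\<integral>x. G\<^sub>1 x \<bullet> (G\<^sub>1 x - G\<^sub>0 x) \<partial>M) - (\<integral>x. L_tilde L T \<bullet> \<delta> x \<partial>M)
        + (1 / \<epsilon>) * (\<integral>x. \<phi>\<^sub>0 x \<bullet> \<delta> x \<partial>M) - c\<^sub>v * (\<integral>x. (\<theta>\<^sub>1 x / \<theta>\<^sub>0 x)\<^sup>2 - \<theta>\<^sub>1 x / \<theta>\<^sub>0 x \<partial>M)"
      unfolding g_def using I[OF grad_L2(2) D] I[OF c \<delta>] I[OF L2(1) \<delta>] int_r by simp
    then have g_nonneg: "0 \<le> integral\<^sup>L M g" using phase temp by linarith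
    have "AE x in M. (A\<^sub>0 x - c\<^sub>v * ln (\<theta>\<^sub>0 x)) + g x \<le> A\<^sub>1 x - c\<^sub>v * ln (\<theta>\<^sub>1 x)"
      using \<theta>\<^sub>0_pos \<theta>\<^sub>1_pos unfolding M_def
    proof eventually_elim
      case (elim x)
      have "ln (\<theta>\<^sub>1 x) - ln (\<theta>\<^sub>0 x) \<le> (\<theta>\<^sub>1 x / \<theta>\<^sub>0 x)\<^sup>2 - \<theta>\<^sub>1 x / \<theta>\<^sub>0 x"
        using ln_le_square_minus_self[of "\<theta>\<^sub>1 x / \<theta>\<^sub>0 x"] elim by (simp add: ln_div)
      then have "c\<^sub>v * (ln (\<theta>\<^sub>1 x) - ln (\<theta>\<^sub>0 x)) \<le> c\<^sub>v * ((\<theta>\<^sub>1 x / \<theta>\<^sub>0 x)\<^sup>2 - \<theta>\<^sub>1 x / \<theta>\<^sub>0 x)"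
        using \<open>c\<^sub>v > 0\<close> by (intro mult_left_mono) auto
      moreover have "A\<^sub>1 x - A\<^sub>0 x =
          - (L_tilde L T \<bullet> \<delta> x) - \<epsilon> * (G\<^sub>1 x \<bullet> (G\<^sub>1 x - G\<^sub>0 x)) + (1 / \<epsilon>) * (\<phi>\<^sub>0 x \<bullet> \<delta> x)
          + \<epsilon> / 2 * (norm (G\<^sub>1 x - G\<^sub>0 x))\<^sup>2 + 1 / (2 * \<epsilon>) * (norm (\<delta> x))\<^sup>2"
        using \<open>\<epsilon> > 0\<close>
        by (simp add: A\<^sub>0_def A\<^sub>1_def \<delta>_def power2_norm_eq_inner inner_diff_left inner_diff_right
            inner_commute[of "G\<^sub>0 x" "G\<^sub>1 x"] inner_commute[of "\<phi>\<^sub>0 x" "\<phi>\<^sub>1 x"]) (simp add: field_simps)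
      moreover have "0 \<le> \<epsilon> / 2 * (norm (G\<^sub>1 x - G\<^sub>0 x))\<^sup>2 + 1 / (2 * \<epsilon>) * (norm (\<delta> x))\<^sup>2"
        using \<open>\<epsilon> > 0\<close> by simp
      ultimately show ?case unfolding g_def by (simp only: right_diff_distrib)
    qed
    then have "ext_integral M (\<lambda>x. A\<^sub>0 x - c\<^sub>v * ln (\<theta>\<^sub>0 x) + g x) \<le> ext_integral M (\<lambda>x. A\<^sub>1 x - c\<^sub>v * ln (\<theta>\<^sub>1 x))"
      by (rule ext_integral_mono)
    moreover have "ext_integral M (\<lambda>x. A\<^sub>0 x - c\<^sub>v * ln (\<theta>\<^sub>0 x))
        \<le> ext_integral M (\<lambda>x. A\<^sub>0 x - c\<^sub>v * ln (\<theta>\<^sub>0 x) + g x)"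
      using g_nonneg int_f\<^sub>0 int_g
      by (subst (1 2) ext_integral_eq_integral) (auto simp: Bochner_Integration.integral_add[OF int_f\<^sub>0 int_g])
    ultimately show ?thesis
      using True gibbs(1) by (simp add: S chi_gibbs_def)
  qed
qed

end
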